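(* Let $G$ be an almost Moore mixed graph of diameter $3$, i.e. a finite totally regular mixed graph with undirected degree $r\ge 1$, directed degree $z\ge 1$, diameter $3$ and exactly $M(r,z,3)-1$ vertices. Let $\boldsymbol{A}$ be the adjacency matrix of $G$, and write $\boldsymbol{A}=\boldsymbol{R}+\boldsymbol{Z}$, where $\boldsymbol{R}$ and $\boldsymbol{Z}$ are the adjacency matrices of the subgraphs of $G$ induced by the edges and by the arcs of $G$, respectively. Then the following hold. (a) There exists a permutation matrix $\boldsymbol{P}$ such that $$\boldsymbol{A}^2+\boldsymbol{A}^3=\boldsymbol{J}+\boldsymbol{Z}+\boldsymbol{P}.$$ (b) The mapping $\sigma:V(G)\to V(G)$ represented by this matrix $\boldsymbol{P}$ (that is, $\boldsymbol{P}_{uv}=1$ if and only if $\sigma(u)=v$) is not an automorphism of $G$. (c) If $\boldsymbol{P}=\boldsymbol{R}$, then $G$ is (isomorphic to) the Cayley graph of the dihedral group $D_5=\langle \rho,s \mid \rho^5=s^2=(\rho s)^2=1\rangle$ with generators $\rho$ and $s$.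
   Context: A mixed graph $G$ has a finite vertex set $V(G)$ and may contain (undirected) edges as well as directed edges (arcs); there are no loops or parallel edges/arcs, and a digon (a pair of opposite arcs $u\to v$, $v\to u$) is always considered as an edge. Thus, between two distinct vertices there is either nothing, one edge, or one arc in exactly one direction. $G$ is totally regular with degrees $(r,z)$ if each vertex is incident to exactly $r$ edges and has exactly $z$ outgoing arcs and exactly $z$ incoming arcs. Walks may traverse edges in both directions and arcs only in their direction; the distance from $u$ to $v$ is the length of a shortest walk from $u$ to $v$, and the diameter is the maximum distance over all ordered pairs of vertices. The adjacency matrix $\boldsymbol{A}$ is the $0/1$ matrix indexed by $V(G)$ with $\boldsymbol{A}_{uv}=1$ iff there is an edge joining $u$ and $v$ or an arc from $u$ to $v$. So $\boldsymbol{R}_{uv}=1$ iff $u,v$ are joined by an edge, and $\boldsymbol{Z}_{uv}=1$ iff there is an arc from $u$ to $v$. $\boldsymbol{J}$ is the all-ones matrix. An automorphism of $G$ is a permutation of $V(G)$ preserving edges and arcs. The Moore bound for mixed graphs is $$M(r,z,k)=A\frac{u_1^{k+1}-1}{u_1-1}+B\frac{u_2^{k+1}-1}{u_2-1},$$ where $v=(z+r)^2+2(z-r)+1$, $A=\frac{\sqrt{v}-(z+r+1)}{2\sqrt{v}}$, $B=\frac{\sqrt{v}+(z+r+1)}{2\sqrt{v}}$, $u_1=\frac{z+r-1-\sqrt{v}}{2}$, $u_2=\frac{z+r-1+\sqrt{v}}{2}$. The Cayley graph of a group $\Gamma$ with generators $\rho,s$ is the mixed graph with vertex set $\Gamma$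 and adjacencies from $g$ to $g\rho$ and from $g$ to $gs$ for all $g\in\Gamma$, opposite arcs (such as those given by the involution $s$) forming edges. *)

theory Defs
  imports "HOL-Analysis.Analysis" "HOL-Algebra.Group" "HOL-Library.Extended_Nat"
begin

section \<open>Mixed graphs\<close>

record 'v mixed_graph =
  verts :: "'v set"
  edges :: "'v set set"
  arcs :: "('v \<times> 'v) set"

text \<open>Between two distinct vertices there is nothing, one edge, or one arc in exactly one
  direction; in particular a digon can only be represented as an edge.\<close>

definition wf_mixed_graph :: "'v mixed_graph \<Rightarrow> bool" where
  "wf_mixed_graph G \<longleftrightarrow>
     finite (verts G) \<and>
     edges G \<subseteq> {{u, v} |u v. u \<in> verts G \<and> v \<in> verts G \<and> u \<noteq> v} \<and>
     arcs G \<subseteq> verts G \<times> verts G \<and>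
     (\<forall>u v. (u, v) \<in> arcs G \<longrightarrow> u \<noteq> v \<and> (v, u) \<notin> arcs G \<and> {u, v} \<notin> edges G)"

definition totally_regular :: "nat \<Rightarrow> nat \<Rightarrow> 'v mixed_graph \<Rightarrow> bool" where
  "totally_regular r z G \<longleftrightarrow>
     (\<forall>v\<in>verts G. card {e \<in> edges G. v \<in> e} = r \<and>
        card {w. (v, w) \<in> arcs G} = z \<and> card {w. (w, v) \<in> arcs G} = z)"

definition adj :: "'v mixed_graph \<Rightarrow> ('v \<times> 'v) set" where
  "adj G = {(u, v). {u, v} \<in> edges G \<or> (u, v) \<in> arcs G}"

text \<open>A walk of length \<open>n\<close> from \<open>u\<close> to \<open>v\<close> exists iff \<open>(u, v) \<in> adj G ^^ n\<close>; the distance is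
  \<open>\<infinity>\<close> if there is no walk.\<close>

definition distance :: "'v mixed_graph \<Rightarrow> 'v \<Rightarrow> 'v \<Rightarrow> enat" where
  "distance G u v = (INF n\<in>{n. (u, v) \<in> adj G ^^ n}. enat n)"

definition graph_diameter :: "'v mixed_graph \<Rightarrow> enat" where
  "graph_diameter G = (SUP (u, v)\<in>verts G \<times> verts G. distance G u v)"

definition moore_bound :: "nat \<Rightarrow> nat \<Rightarrow> nat \<Rightarrow> real" where
  "moore_bound r z k =
    (let v = (real z + real r)^2 + 2 * (real z - real r) + 1;
         A = (sqrt v - (real z + real r + 1)) / (2 * sqrt v);
         B = (sqrt v + (real z + real r + 1)) / (2 * sqrt v);
         u1 = (real z + real r - 1 - sqrt v) / 2;
         u2 = (real z + real r - 1 + sqrt v) / 2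
     in A * ((u1 ^ (k + 1) - 1) / (u1 - 1)) + B * ((u2 ^ (k + 1) - 1) / (u2 - 1)))"

definition almost_moore :: "nat \<Rightarrow> nat \<Rightarrow> nat \<Rightarrow> 'v mixed_graph \<Rightarrow> bool" where
  "almost_moore r z k G \<longleftrightarrow>
     wf_mixed_graph G \<and> totally_regular r z G \<and> graph_diameter G = enat k \<and>
     real (card (verts G)) = moore_bound r z k - 1"

definition mixed_graph_iso :: "('v \<Rightarrow> 'w) \<Rightarrow> 'v mixed_graph \<Rightarrow> 'w mixed_graph \<Rightarrow> bool" where
  "mixed_graph_iso f G H \<longleftrightarrow>
     bij_betw f (verts G) (verts H) \<and>
     (\<forall>u\<in>verts G. \<forall>v\<in>verts G.
        ({f u, f v} \<in> edges H \<longleftrightarrow> {u, v} \<in> edges G) \<and>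
        ((f u, f v) \<in> arcs H \<longleftrightarrow> (u, v) \<in> arcs G))"

definition isomorphic :: "'v mixed_graph \<Rightarrow> 'w mixed_graph \<Rightarrow> bool" where
  "isomorphic G H \<longleftrightarrow> (\<exists>f. mixed_graph_iso f G H)"

definition automorphism :: "'v mixed_graph \<Rightarrow> ('v \<Rightarrow> 'v) \<Rightarrow> bool" where
  "automorphism G f \<longleftrightarrow> mixed_graph_iso f G G"

definition edge_subgraph :: "'v mixed_graph \<Rightarrow> 'v mixed_graph" where
  "edge_subgraph G = G\<lparr>arcs := {}\<rparr>"

definition arc_subgraph :: "'v mixed_graph \<Rightarrow> 'v mixed_graph" where
  "arc_subgraph G = G\<lparr>edges := {}\<rparr>"


section \<open>Matrices\<close>

text \<open>Rows and columns are indexed by the whole vertex type, so this is the adjacency matrix of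
  \<open>G\<close> when \<open>verts G = UNIV\<close>.\<close>

definition adjacency_matrix :: "('v::finite) mixed_graph \<Rightarrow> real^'v^'v" where
  "adjacency_matrix G = (\<chi> u v. if (u, v) \<in> adj G then 1 else 0)"

definition all_ones :: "real^('v::finite)^'v" where
  "all_ones = (\<chi> u v. 1)"

definition permutation_matrix :: "real^('v::finite)^'v \<Rightarrow> bool" where
  "permutation_matrix P \<longleftrightarrow>
     (\<forall>u v. P $ u $ v \<in> {0, 1}) \<and> (\<forall>u. \<exists>!v. P $ u $ v = 1) \<and> (\<forall>v. \<exists>!u. P $ u $ v = 1)"

lemma adjacency_matrix_decomp:
  assumes "wf_mixed_graph G"
  shows "adjacency_matrix G = adjacency_matrix (edge_subgraph G) + adjacency_matrix (arc_subgraph G)"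
  using assms
  by (auto simp: vec_eq_iff adjacency_matrix_def edge_subgraph_def arc_subgraph_def adj_def
      wf_mixed_graph_def)


section \<open>Groups given by a presentation\<close>

text \<open>Words over the generators and their formal inverses: \<open>(x, True)\<close> stands for \<open>x\<close> and
  \<open>(x, False)\<close> for its inverse. The presented group is the set of words modulo the least
  congruence that contains free cancellation and makes all relators trivial.\<close>

type_synonym 'g word = "('g \<times> bool) list"

inductive word_eq :: "'g word set \<Rightarrow> 'g word \<Rightarrow> 'g word \<Rightarrow> bool" for R where
  refl: "word_eq R a a"
| sym: "word_eq R a b \<Longrightarrow> word_eq R b a"
| trans: "word_eq R a b \<Longrightarrow> word_eq R b c \<Longrightarrow> word_eq R a c"
| append: "word_eq R a b \<Longrightarrow> word_eq R c d \<Longrightarrow> word_eq R (a @ c) (b @ d)"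
| cancel: "word_eq R [(x, e), (x, \<not> e)] []"
| relator: "w \<in> R \<Longrightarrow> word_eq R w []"

definition word_class :: "'g word set \<Rightarrow> 'g word \<Rightarrow> 'g word set" where
  "word_class R a = {b. word_eq R a b}"

definition presented_group :: "'g word set \<Rightarrow> 'g word set monoid" where
  "presented_group R =
    \<lparr>carrier = range (word_class R),
     mult = (\<lambda>X Y. {c. \<exists>a\<in>X. \<exists>b\<in>Y. word_eq R (a @ b) c}),
     one = word_class R []\<rparr>"

definition presented_generator :: "'g word set \<Rightarrow> 'g \<Rightarrow> 'g word set" where
  "presented_generator R x = word_class R [(x, True)]"

lemma word_class_eq_iff: "word_class R a = word_class R b \<longleftrightarrow> word_eq R a b"
  unfolding word_class_def by (blast intro: word_eq.refl word_eq.sym word_eq.trans)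

lemma presented_group_mult:
  "word_class R a \<otimes>\<^bsub>presented_group R\<^esub> word_class R b = word_class R (a @ b)"
  unfolding presented_group_def word_class_def
  by (auto intro: word_eq.refl word_eq.sym word_eq.trans word_eq.append)

lemma word_eq_inverse: "word_eq R (rev (map (\<lambda>(x, e). (x, \<not> e)) a) @ a) []"
proof (induction a)
  case Nil
  then show ?case by (simp add: word_eq.refl)
next
  case (Cons p a)
  obtain x e where p: "p = (x, e)" by (cases p)
  let ?i = "rev (map (\<lambda>(x, e). (x, \<not> e)) a)"
  have "word_eq R ([(x, \<not> e), (x, e)] @ a) ([] @ a)"
    using word_eq.cancel[of R x "\<not> e"] by (intro word_eq.append word_eq.refl) simp
  then have "word_eq R (?i @ [(x, \<not> e), (x, e)] @ a) (?i @ a)"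
    by (intro word_eq.append word_eq.refl) simp
  then show ?case
    using Cons.IH by (auto simp: p intro: word_eq.trans)
qed

lemma group_presented_group: "group (presented_group R)"
proof (rule groupI)
  fix X assume "X \<in> carrier (presented_group R)"
  then obtain a where a: "X = word_class R a"
    by (auto simp: presented_group_def)
  have one: "\<one>\<^bsub>presented_group R\<^esub> = word_class R []"
    by (simp add: presented_group_def)
  show "\<one>\<^bsub>presented_group R\<^esub> \<otimes>\<^bsub>presented_group R\<^esub> X = X"
    by (simp add: a one presented_group_mult)
  show "\<exists>Y\<in>carrier (presented_group R). Y \<otimes>\<^bsub>presented_group R\<^esub> X = \<one>\<^bsub>presented_group R\<^esub>"
  proof
    show "word_class R (rev (map (\<lambda>(x, e). (x, \<not> e)) a)) \<otimes>\<^bsub>presented_group R\<^esub> X = \<one>\<^bsub>presented_group R\<^esub>"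
      by (simp add: a one presented_group_mult word_class_eq_iff word_eq_inverse)
  qed (simp add: presented_group_def)
next
  have carrier: "carrier (presented_group R) = range (word_class R)"
    and one: "\<one>\<^bsub>presented_group R\<^esub> = word_class R []"
    by (simp_all add: presented_group_def)
  show "\<one>\<^bsub>presented_group R\<^esub> \<in> carrier (presented_group R)"
    by (simp add: carrier one)
  show "X \<otimes>\<^bsub>presented_group R\<^esub> Y \<in> carrier (presented_group R)"
    if "X \<in> carrier (presented_group R)" "Y \<in> carrier (presented_group R)" for X Y
    using that by (auto simp: carrier presented_group_mult)
  show "X \<otimes>\<^bsub>presented_group R\<^esub> Y \<otimes>\<^bsub>presented_group R\<^esub> Z
      = X \<otimes>\<^bsub>presented_group R\<^esub> (Y \<otimes>\<^bsub>presented_group R\<^esub> Z)"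
    if "X \<in> carrier (presented_group R)" "Y \<in> carrier (presented_group R)"
       "Z \<in> carrier (presented_group R)" for X Y Z
    using that by (auto simp: carrier presented_group_mult)
qed

datatype dihedral_gen = Rho | Refl

text \<open>The relators \<open>\<rho>\<^sup>n\<close>, \<open>s\<^sup>2\<close> and \<open>(\<rho>s)\<^sup>2\<close>.\<close>

definition dihedral_relators :: "nat \<Rightarrow> dihedral_gen word set" where
  "dihedral_relators n =
    {replicate n (Rho, True),
     [(Refl, True), (Refl, True)],
     [(Rho, True), (Refl, True), (Rho, True), (Refl, True)]}"

definition dihedral_group :: "nat \<Rightarrow> dihedral_gen word set monoid" where
  "dihedral_group n = presented_group (dihedral_relators n)"

definition dihedral_rho :: "nat \<Rightarrow> dihedral_gen word set" where
  "dihedral_rho n = presented_generator (dihedral_relators n) Rho"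

definition dihedral_s :: "nat \<Rightarrow> dihedral_gen word set" where
  "dihedral_s n = presented_generator (dihedral_relators n) Refl"


section \<open>Cayley graphs as mixed graphs\<close>

definition cayley_adj :: "('a, 'm) monoid_scheme \<Rightarrow> 'a set \<Rightarrow> ('a \<times> 'a) set" where
  "cayley_adj \<Gamma> S = {(g, g \<otimes>\<^bsub>\<Gamma>\<^esub> x) |g x. g \<in> carrier \<Gamma> \<and> x \<in> S}"

definition cayley_graph :: "('a, 'm) monoid_scheme \<Rightarrow> 'a set \<Rightarrow> 'a mixed_graph" where
  "cayley_graph \<Gamma> S =
    \<lparr>verts = carrier \<Gamma>,
     edges = {{g, h} |g h. (g, h) \<in> cayley_adj \<Gamma> S \<and> (h, g) \<in> cayley_adj \<Gamma> S},
     arcs = {(g, h). (g, h) \<in> cayley_adj \<Gamma> S \<and> (h, g) \<notin> cayley_adj \<Gamma> S}\<rparr>"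

end

theory Submission
  imports Defs
begin

text \<open>Call a walk nonbacktracking if it never uses the same edge twice in succession. With
  \<open>d = r + z\<close>, the matrix \<open>N = (1 - r)I + (1 - 2r)A + R + A\<^sup>2 + A\<^sup>3\<close> counts the nonbacktracking
  walks of length at most three. All its entries are positive, because the diameter is three, and
  its rows and columns have the sum \<open>M(r,z,3) = n + 1\<close>; hence \<open>N = J + P\<close> for a permutation
  matrix \<open>P\<close>, and the claimed equation says that \<open>r = 1\<close>. Commuting \<open>N\<close> with \<open>A\<close> gives
  \<open>RZ + AP = ZR + PA\<close>.

  If \<open>\<sigma>\<close> were an automorphism, then \<open>RZ = ZR\<close>, so \<open>RZ\<^sup>2 = ZRZ = Z\<^sup>2R\<close> would give three walks with
  the same ends, but the entries of \<open>N\<close> are at most two. If \<open>r \<ge> 2\<close>, this bound forces \<open>RZ \<le> PA\<close>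
  and \<open>ZR \<le> AP\<close>; counting then leaves \<open>z = 1\<close> or \<open>r = z = 2\<close>, and in both cases
  \<open>R\<^sup>2Z = ZR\<^sup>2\<close>, which again produces too many walks.

  If \<open>P = R\<close>, then \<open>A\<^sup>3 + A\<^sup>2 - A = J\<close>, and the irrationality of the eigenvalues
  \<open>(-1 \<plusminus> \<surd>5) / 2\<close> forces \<open>z = 1\<close>, so \<open>n = 10\<close>. Edges and arcs are then
  permutations \<open>\<sigma>\<close> and \<open>\<tau>\<close>, and the uniqueness of walks yields the relations of the dihedral
  group.\<close>

section \<open>Matrices\<close>

lemma matrix_diff_ldistrib:
  fixes A :: "'a::ring_1^'n^'m" shows "A ** (B - C) = A ** B - A ** C"
  by (simp add: matrix_matrix_mult_def vec_eq_iff sum_subtractf right_diff_distrib)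

lemma matrix_diff_rdistrib:
  fixes A :: "'a::ring_1^'n^'m" shows "(A - B) ** C = A ** C - B ** C"
  by (simp add: matrix_matrix_mult_def vec_eq_iff sum_subtractf left_diff_distrib)

lemma matrix_add_rdistrib:
  fixes A :: "'a::semiring_1^'n^'m" shows "(A + B) ** C = A ** C + B ** C"
  by (simp add: matrix_matrix_mult_def vec_eq_iff sum.distrib distrib_right)

lemma matrix_scaleR_left: "(k *\<^sub>R A) ** B = k *\<^sub>R (A ** B)" for A :: "real^'n^'m"
  by (rule scalar_matrix_assoc[symmetric])

lemma matrix_scaleR_right: "A ** (k *\<^sub>R B) = k *\<^sub>R (A ** B)" for A :: "real^'n^'m"
  by (simp add: matrix_scalar_ac scalar_matrix_assoc)

lemmas matrix_ring = matrix_add_ldistrib matrix_add_rdistrib matrix_diff_ldistrib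
  matrix_diff_rdistrib matrix_scaleR_left matrix_scaleR_right matrix_mul_assoc

lemma matrix_mult_nth: "(A ** B) $ u $ w = (\<Sum>v\<in>UNIV. A $ u $ v * B $ v $ w)"
  by (simp add: matrix_matrix_mult_def)

definition nat_matrix :: "real^'n^'m \<Rightarrow> bool" where
  "nat_matrix A \<longleftrightarrow> (\<forall>u v. A $ u $ v \<in> \<nat>)"

lemma nat_matrix_nonneg: "nat_matrix A \<Longrightarrow> 0 \<le> A $ u $ v"
  by (metis nat_matrix_def Nats_cases of_nat_0_le_iff)

lemma nat_matrix_ge_1: "nat_matrix A \<Longrightarrow> A $ u $ v \<noteq> 0 \<Longrightarrow> 1 \<le> A $ u $ v"
proof -
  assume "nat_matrix A" "A $ u $ v \<noteq> 0"
  then obtain k where "A $ u $ v = real k" "k \<noteq> 0"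
    by (metis nat_matrix_def Nats_cases of_nat_0)
  then show ?thesis by simp
qed

lemma sum_in_Nats: "(\<And>x. x \<in> X \<Longrightarrow> f x \<in> \<nat>) \<Longrightarrow> sum f X \<in> \<nat>"
  by (induction X rule: infinite_finite_induct) auto

lemma nat_matrix_mult: "nat_matrix A \<Longrightarrow> nat_matrix B \<Longrightarrow> nat_matrix (A ** B)"
  unfolding nat_matrix_def matrix_mult_nth by (intro allI sum_in_Nats Nats_mult) auto

lemma nat_matrix_add: "nat_matrix A \<Longrightarrow> nat_matrix B \<Longrightarrow> nat_matrix (A + B)"
  by (simp add: nat_matrix_def)

lemma nat_matrix_mat_1: "nat_matrix (mat 1)"
  by (simp add: nat_matrix_def mat_def)

lemma matrix_mult_nth_ge:
  assumes "nat_matrix A" "nat_matrix B"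
  shows "A $ u $ v * B $ v $ w \<le> (A ** B) $ u $ w"
  unfolding matrix_mult_nth
  by (rule member_le_sum) (simp_all add: assms nat_matrix_nonneg)

lemma matrix_mult_nth_ge2:
  assumes "nat_matrix A" "nat_matrix B" "v \<noteq> v'"
  shows "A $ u $ v * B $ v $ w + A $ u $ v' * B $ v' $ w \<le> (A ** B) $ u $ w"
proof -
  have "A $ u $ v * B $ v $ w + A $ u $ v' * B $ v' $ w = (\<Sum>x\<in>{v, v'}. A $ u $ x * B $ x $ w)"
    using assms(3) by simp
  also have "\<dots> \<le> (A ** B) $ u $ w"
    unfolding matrix_mult_nth by (rule sum_mono2) (simp_all add: assms nat_matrix_nonneg)
  finally show ?thesis .
qed

lemma matrix_mult_nth_neq_0E:
  assumes "(A ** B) $ u $ w \<noteq> (0::real)"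
  obtains v where "A $ u $ v \<noteq> 0" "B $ v $ w \<noteq> 0"
  using assms unfolding matrix_mult_nth by (metis (no_types, lifting) mult_eq_0_iff sum.neutral)

lemma all_ones_nth [simp]: "all_ones $ u $ v = 1"
  by (simp add: all_ones_def)

lemma mult_all_ones_nth: "(A ** all_ones) $ u $ w = (\<Sum>v\<in>UNIV. A $ u $ v)"
  by (simp add: matrix_mult_nth all_ones_def)

lemma all_ones_mult_nth: "(all_ones ** A) $ u $ w = (\<Sum>v\<in>UNIV. A $ v $ w)"
  by (simp add: matrix_mult_nth all_ones_def)

lemma all_ones_mult_all_ones:
  "(all_ones :: real^'n^'n) ** all_ones = real CARD('n::finite) *\<^sub>R all_ones"
  by (simp add: matrix_mult_nth all_ones_def vec_eq_iff)

text \<open>The entries of \<open>B - A\<close> are nonnegative and add up to zero in each row. With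
  row sums expressed as products with \<open>all_ones\<close>, the second hypothesis follows from
  matrix algebra.\<close>

lemma matrix_eq_of_le_of_row_sums:
  fixes A B :: "real^'n^'n"
  assumes le: "\<And>u v. A $ u $ v \<le> B $ u $ v" and sums: "A ** all_ones = B ** all_ones"
  shows "A = B"
proof -
  have "A $ u $ v = B $ u $ v" for u v
  proof -
    have "(\<Sum>v\<in>UNIV. B $ u $ v - A $ u $ v) = 0"
      using sums mult_all_ones_nth[of A u undefined] mult_all_ones_nth[of B u undefined]
      by (simp add: sum_subtractf)
    then have "\<forall>v\<in>UNIV. B $ u $ v - A $ u $ v = 0"
      using le by (subst (asm) sum_nonneg_eq_0_iff) auto
    then show ?thesis by simp
  qed
  then show ?thesis by (simp add: vec_eq_iff)
qed

text \<open>A nonzero idempotent \<open>E\<close> splits off the rank one idempotent \<open>v w\<^sup>T\<close>, where \<open>v\<close> is a column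
  and \<open>w\<close> a normalized row of \<open>E\<close> through a nonzero entry; this lowers rank and trace by one.\<close>

lemma trace_idempotent_Nats:
  fixes E :: "real^'n^'n"
  assumes "E ** E = E"
  shows "trace E \<in> \<nat>"
  using assms
proof (induction "rank E" arbitrary: E rule: less_induct)
  case less
  show ?case
  proof (cases "E = 0")
    case True
    then show ?thesis by (simp add: trace_def)
  next
    case False
    then obtain i j where ij: "E $ i $ j \<noteq> 0" by (auto simp: vec_eq_iff)
    define F :: "real^'n^'n" where "F = (\<chi> u v. E $ u $ j * E $ i $ v / E $ i $ j)"
    have idem: "(\<Sum>v\<in>UNIV. E $ a $ v * E $ v $ b) = E $ a $ b" for a b
      using arg_cong[OF less.prems, of "\<lambda>M. M $ a $ b"] by (simp add: matrix_mult_nth)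
    have EF: "E ** F = F"
      by (simp add: vec_eq_iff matrix_mult_nth F_def idem flip: mult.assoc sum_divide_distrib sum_distrib_right)
    have FE: "F ** E = F"
      by (simp add: vec_eq_iff matrix_mult_nth F_def idem mult.assoc flip: sum_divide_distrib sum_distrib_left)
    have FF: "F ** F = F"
    proof -
      have "(\<Sum>v\<in>UNIV. F $ a $ v * F $ v $ b) = F $ a $ b" for a b
      proof -
        have "F $ a $ v * F $ v $ b
            = E $ a $ j * E $ i $ b / (E $ i $ j * E $ i $ j) * (E $ i $ v * E $ v $ j)" for v
          by (simp add: F_def)
        then have "(\<Sum>v\<in>UNIV. F $ a $ v * F $ v $ b)
            = E $ a $ j * E $ i $ b / (E $ i $ j * E $ i $ j) * (\<Sum>v\<in>UNIV. E $ i $ v * E $ v $ j)"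
          by (simp only: sum_distrib_left)
        then show ?thesis
          using ij by (simp add: idem F_def)
      qed
      then show ?thesis by (simp add: vec_eq_iff matrix_mult_nth)
    qed
    have "trace F = 1"
    proof -
      have "trace F = (\<Sum>v\<in>UNIV. E $ i $ v * E $ v $ j) / E $ i $ j"
        by (simp add: trace_def F_def mult.commute flip: sum_divide_distrib)
      then show ?thesis using ij by (simp add: idem)
    qed
    have idem': "(E - F) ** (E - F) = E - F"
      by (simp add: matrix_ring EF FE FF less.prems)
    have "rank (E - F) < rank E"
    proof -
      have sub: "range ((*v) (E - F)) \<subseteq> range ((*v) E)"
      proof -
        have "E ** (E - F) = E - F" by (simp add: matrix_ring EF less.prems)
        then show ?thesis
          by (metis image_subsetI matrix_vector_mul_assoc rangeI)
      qed
      define x :: "real^'n" where "x = column j E"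
      have x: "x = E *v axis j 1" by (simp add: x_def matrix_vector_mult_basis)
      have Fx: "F *v x = x"
      proof -
        have "(\<Sum>v\<in>UNIV. F $ a $ v * E $ v $ j) = E $ a $ j" for a
        proof -
          have "F $ a $ v * E $ v $ j = E $ a $ j / E $ i $ j * (E $ i $ v * E $ v $ j)" for v
            by (simp add: F_def)
          then have "(\<Sum>v\<in>UNIV. F $ a $ v * E $ v $ j)
              = E $ a $ j / E $ i $ j * (\<Sum>v\<in>UNIV. E $ i $ v * E $ v $ j)"
            by (simp only: sum_distrib_left)
          then show ?thesis using ij by (simp add: idem)
        qed
        then show ?thesis by (simp add: vec_eq_iff matrix_vector_mult_def x_def column_def)
      qed
      have Ex: "E *v x = x" by (simp add: x matrix_vector_mul_assoc less.prems)
      \<comment> \<open>The idempotent \<open>E - F\<close> fixes its range pointwise, but it sends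
        the nonzero column \<open>x\<close> of \<open>E\<close> to zero.\<close>
      have "x \<notin> range ((*v) (E - F))"
      proof
        assume "x \<in> range ((*v) (E - F))"
        then obtain y where "x = (E - F) *v y" by auto
        then have "(E - F) *v x = x" by (simp add: matrix_vector_mul_assoc idem')
        then have "x = 0" by (simp add: matrix_vector_mult_diff_rdistrib Ex Fx)
        then show False using ij by (auto simp: x_def column_def vec_eq_iff)
      qed
      then have "range ((*v) (E - F)) \<subset> range ((*v) E)"
        using sub x by blast
      moreover have sp: "span (range ((*v) M)) = range ((*v) M)" for M :: "real^'n^'n"
        by (simp add: span_eq_iff linear_subspace_image subspace_UNIV)
      ultimately show ?thesis
        unfolding rank_dim_range by (intro dim_psubset) (simp only: sp)
    qed
    then have "trace (E - F) \<in> \<nat>"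
      using less.hyps idem' by blast
    then have "trace (E - F) + 1 \<in> \<nat>" by simp
    then show ?thesis by (simp add: trace_sub \<open>trace F = 1\<close>)
  qed
qed

section \<open>The Moore bound for diameter three\<close>

text \<open>The sequence \<open>a * x^i + b * y^i\<close> starts with 1, \<open>d\<close> and obeys
  s(i+2) = (d - 1) s(i+1) + z s(i), since \<open>x\<close> and \<open>y\<close> are the roots of the
  characteristic polynomial. The bound is the sum of its first four terms.\<close>

lemma moore_bound_3:
  fixes r z :: nat and d :: real
  assumes "r \<ge> 1" "z \<ge> 1" and d_def: "d = real r + real z"
  shows "moore_bound r z 3 = 1 + d + d^2 + d^3 - 2 * r * d"
proof -
  define v where "v = (real z + real r)^2 + 2 * (real z - real r) + 1"
  define q where "q = sqrt v"
  have "v = z^2 + 2 * z * r + (real r - 1)^2 + 2 * z"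
    by (simp add: v_def power2_eq_square algebra_simps)
  also have "\<dots> > 0" using assms by (intro add_nonneg_pos add_nonneg_nonneg) auto
  finally have "v > 0" .
  then have q: "q > 0" "q * q = v" by (simp_all add: q_def)
  define a where "a = (q - (real z + real r + 1)) / (2 * q)"
  define b where "b = (q + (real z + real r + 1)) / (2 * q)"
  define x where "x = (real z + real r - 1 - q) / 2"
  define y where "y = (real z + real r - 1 + q) / 2"
  have xy: "x + y = d - 1" "x * y = - real z"
    using q by (simp_all add: x_def y_def d_def field_simps v_def power2_eq_square)
  \<comment> \<open>This product is negative, so both quotients in the bound are genuine geometric
    sums.\<close>
  have "(x - 1) * (y - 1) = 2 - 2 * real z - real r"
    using xy by (simp add: algebra_simps d_def)
  then have ne: "x \<noteq> 1" "y \<noteq> 1" using assms by auto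
  have geo: "(t ^ 4 - 1) / (t - 1) = 1 + t + t^2 + t^3" if "t \<noteq> 1" for t :: real
    using that by (simp add: field_simps eval_nat_numeral)
  have x2: "x^2 = (d - 1) * x + z" and y2: "y^2 = (d - 1) * y + z"
    using xy by (simp_all add: power2_eq_square) (metis add_diff_cancel_right' diff_minus_eq_add
        left_diff_distrib mult.commute add_diff_cancel_left')+
  have s0: "a + b = 1" using q(1) by (simp add: a_def b_def field_simps)
  have s1: "a * x + b * y = d"
    using q(1) by (simp add: a_def b_def x_def y_def d_def field_simps)
  have s2: "a * x^2 + b * y^2 = (d - 1) * d + z"
    unfolding x2 y2 using s0 s1 by algebra
  have s3: "a * x^3 + b * y^3 = (d - 1) * ((d - 1) * d + z) + z * d"
  proof -
    have "x^3 = (d - 1) * x^2 + z * x" "y^3 = (d - 1) * y^2 + z * y"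
      using x2 y2 by algebra+
    then show ?thesis using s1 s2 by algebra
  qed
  have "moore_bound r z 3 = a * (1 + x + x^2 + x^3) + b * (1 + y + y^2 + y^3)"
    unfolding moore_bound_def Let_def
    using geo[OF ne(1)] geo[OF ne(2)]
    by (simp add: a_def b_def x_def y_def q_def v_def)
  also have "\<dots> = 1 + d + ((d - 1) * d + z) + ((d - 1) * ((d - 1) * d + z) + z * d)"
    using s0 s1 s2 s3 by algebra
  also have "\<dots> = 1 + d + d^2 + d^3 - 2 * r * d"
    by (simp add: d_def power2_eq_square power3_eq_cube algebra_simps)
  finally show ?thesis .
qed

section \<open>Nonbacktracking walks\<close>

text \<open>The graph enters only through its two matrices: \<open>reach\<close> encodes diameter at
  most three, and \<open>card\<close> is M(r,z,3) - 1 in closed form.\<close>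

locale almost_moore_matrices =
  fixes R Z :: "real^('v::finite)^'v" and r z :: nat
  assumes R01: "R $ u $ v \<in> {0, 1}" and Z01: "Z $ u $ v \<in> {0, 1}"
    and R_sym: "R $ u $ v = R $ v $ u" and R_diag: "R $ u $ u = 0"
    and R_Z: "Z $ u $ v = 1 \<Longrightarrow> R $ u $ v = 0" and Z_asym: "Z $ u $ v = 1 \<Longrightarrow> Z $ v $ u = 0"
    and R_ones: "R ** all_ones = real r *\<^sub>R all_ones"
    and Z_ones: "Z ** all_ones = real z *\<^sub>R all_ones"
    and ones_Z: "all_ones ** Z = real z *\<^sub>R all_ones"
    and r: "r \<ge> 1" and z: "z \<ge> 1"
    and reach: "u = v \<or> (R + Z) $ u $ v \<noteq> 0 \<or> ((R + Z) ** (R + Z)) $ u $ v \<noteq> 0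
      \<or> ((R + Z) ** (R + Z) ** (R + Z)) $ u $ v \<noteq> 0"
    and card: "real CARD('v)
      = (real r + real z) + (real r + real z)^2 + (real r + real z)^3 - 2 * r * (real r + real z)"
begin

definition "A = R + Z"

text \<open>\<open>S\<close> and \<open>T\<close> count the nonbacktracking walks of length two and three along edges, and \<open>N\<close> all
  nonbacktracking walks of length at most three.\<close>

definition "S = R ** R - real r *\<^sub>R mat 1"
definition "T = R ** S - (real r - 1) *\<^sub>R R"
definition "N = (1 - real r) *\<^sub>R mat 1 + (1 - 2 * real r) *\<^sub>R A + R + A ** A + A ** A ** A"
definition "P = N - all_ones"

lemma ones_R: "all_ones ** R = real r *\<^sub>R all_ones"
proof -
  have "(all_ones ** R) $ u $ v = (R ** all_ones) $ v $ u" for u v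
    by (simp add: all_ones_mult_nth mult_all_ones_nth R_sym[of _ v])
  then show ?thesis by (simp add: vec_eq_iff R_ones)
qed

lemma Z_diag: "Z $ u $ u = 0"
  using Z_asym[of u u] Z01[of u u] by auto

lemma R_row_sum: "(\<Sum>v\<in>UNIV. R $ u $ v) = real r"
  and Z_row_sum: "(\<Sum>v\<in>UNIV. Z $ u $ v) = real z"
  by (simp_all add: R_ones Z_ones flip: mult_all_ones_nth[of _ u u])

lemma R_neighbour: "\<exists>v. R $ u $ v = 1" and Z_neighbour: "\<exists>v. Z $ u $ v = 1"
proof -
  have "(\<Sum>v\<in>UNIV. R $ u $ v) \<noteq> 0" "(\<Sum>v\<in>UNIV. Z $ u $ v) \<noteq> 0"
    using r z by (simp_all only: R_row_sum Z_row_sum)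
  then show "\<exists>v. R $ u $ v = 1" "\<exists>v. Z $ u $ v = 1"
    using R01 Z01 by (metis empty_iff insert_iff sum.neutral)+
qed

lemma nat_R: "nat_matrix R" and nat_Z: "nat_matrix Z"
  using R01 Z01 unfolding nat_matrix_def by (metis Nats_0 Nats_1 empty_iff insert_iff)+

text \<open>Each of the \<open>r\<close> edges at \<open>u\<close> yields one closed walk of length
  two; the subtracted term removes exactly these.\<close>

lemma S_diag: "S $ u $ u = 0"
proof -
  have "R $ u $ x * R $ x $ u = R $ u $ x" for x
    using R01[of u x] by (auto simp: R_sym[of x u])
  then have "(R ** R) $ u $ u = (\<Sum>x\<in>UNIV. R $ u $ x)"
    unfolding matrix_mult_nth by (simp only:)
  then show ?thesis by (simp add: S_def R_row_sum[simplified] mat_def)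
qed

lemma nat_S: "nat_matrix S"
  unfolding nat_matrix_def
proof (intro allI)
  fix u v
  show "S $ u $ v \<in> \<nat>"
    using nat_matrix_mult[OF nat_R nat_R] S_diag
    by (cases "u = v") (simp_all add: S_def mat_def nat_matrix_def)
qed

lemma S_ge_1:
  assumes "R $ u $ v = 1" "R $ v $ w = 1" "u \<noteq> w"
  shows "S $ u $ w \<ge> 1"
  using matrix_mult_nth_ge[OF nat_R nat_R, of u v w] assms by (simp add: S_def mat_def)

text \<open>Only entries at edges could become negative. For an edge uw, each of the r - 1 other
  neighbours v of u gives the walk u, v, u, w, whose last two steps are counted by \<open>S\<close>;
  these walks pay for the subtracted term.\<close>

lemma nat_T: "nat_matrix T"
  unfolding nat_matrix_def
proof (intro allI)
  fix u w
  have nat: "(R ** S) $ u $ w \<in> \<nat>"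
    using nat_matrix_mult[OF nat_R nat_S] by (simp add: nat_matrix_def)
  show "T $ u $ w \<in> \<nat>"
  proof (cases "R $ u $ w = 0")
    case True
    then show ?thesis using nat by (simp add: T_def)
  next
    case False
    then have uw: "R $ u $ w = 1" using R01[of u w] by auto
    have "real r = (\<Sum>v\<in>UNIV. R $ u $ v)"
      by (simp only: R_row_sum)
    also have "\<dots> = 1 + (\<Sum>v\<in>UNIV - {w}. R $ u $ v)"
      using uw by (simp add: sum.remove[of UNIV w])
    also have "(\<Sum>v\<in>UNIV - {w}. R $ u $ v) \<le> (\<Sum>v\<in>UNIV - {w}. R $ u $ v * S $ v $ w)"
    proof (rule sum_mono)
      fix v assume "v \<in> UNIV - {w}"
      then show "R $ u $ v \<le> R $ u $ v * S $ v $ w"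
        using R01[of u v] S_ge_1[of v u w] R_sym[of u v] uw by auto
    qed
    also have "\<dots> \<le> (R ** S) $ u $ w"
      unfolding matrix_mult_nth
      by (rule sum_mono2) (simp_all add: nat_matrix_nonneg nat_R nat_S)
    finally have "real (r - 1) \<le> (R ** S) $ u $ w" using r by simp
    moreover obtain k where k: "(R ** S) $ u $ w = real k" using nat by (auto elim: Nats_cases)
    ultimately have "r - 1 \<le> k" by simp
    then have "T $ u $ w = real (k - (r - 1))" using r k uw by (simp add: T_def of_nat_diff)
    then show ?thesis by simp
  qed
qed

lemmas nat_matrices = nat_R nat_Z nat_S nat_T nat_matrix_mat_1 nat_matrix_mult nat_matrix_add

text \<open>The summands are the kinds of nonbacktracking walks, sorted by their pattern of edges
  and arcs. All are nonnegative integer matrices, so walks of different kinds with the same ends add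
  up in \<open>N\<close>.\<close>

lemma N_expand: "N = mat 1 + R + Z + S + R ** Z + Z ** R + Z ** Z + T + S ** Z + Z ** S
    + R ** Z ** R + R ** Z ** Z + Z ** R ** Z + Z ** Z ** R + Z ** Z ** Z"
  by (simp add: N_def A_def T_def S_def matrix_ring algebra_simps) (simp add: vec_eq_iff)

lemma N_nth: "N $ u $ w = mat 1 $ u $ w + R $ u $ w + Z $ u $ w + S $ u $ w + (R ** Z) $ u $ w
    + (Z ** R) $ u $ w + (Z ** Z) $ u $ w + T $ u $ w + (S ** Z) $ u $ w + (Z ** S) $ u $ w
    + (R ** Z ** R) $ u $ w + (R ** Z ** Z) $ u $ w + (Z ** R ** Z) $ u $ w
    + (Z ** Z ** R) $ u $ w + (Z ** Z ** Z) $ u $ w"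
  by (simp add: N_expand)

lemma walks_nonneg:
  "0 \<le> (mat 1 :: real^'v^'v) $ u $ w" "0 \<le> R $ u $ w" "0 \<le> Z $ u $ w" "0 \<le> S $ u $ w"
  "0 \<le> (R ** Z) $ u $ w" "0 \<le> (Z ** R) $ u $ w" "0 \<le> (Z ** Z) $ u $ w" "0 \<le> T $ u $ w"
  "0 \<le> (S ** Z) $ u $ w" "0 \<le> (Z ** S) $ u $ w" "0 \<le> (R ** Z ** R) $ u $ w"
  "0 \<le> (R ** Z ** Z) $ u $ w" "0 \<le> (Z ** R ** Z) $ u $ w" "0 \<le> (Z ** Z ** R) $ u $ w"
  "0 \<le> (Z ** Z ** Z) $ u $ w"
  by (simp_all add: nat_matrix_nonneg nat_matrices)

section \<open>The permutation behind the excess of \<open>N\<close> over the all-ones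
  matrix\<close>

lemma nat_N: "nat_matrix N"
  unfolding N_expand by (intro nat_matrices)

text \<open>Walks of length at most one are visible in \<open>N_expand\<close>. For distinct,
  nonadjacent vertices the polynomial definition of \<open>N\<close> reduces to A^2 + A^3 at this
  entry, so a walk that reaches \<open>v\<close> need not be made nonbacktracking first.\<close>

lemma N_ge_1: "N $ u $ v \<ge> 1"
proof -
  note nonneg = walks_nonneg[of u v] N_nth[of u v]
  consider "u = v" | "R $ u $ v = 1" | "Z $ u $ v = 1"
    | "u \<noteq> v" "A $ u $ v = 0" "R $ u $ v = 0" "(A ** A) $ u $ v \<noteq> 0 \<or> (A ** A ** A) $ u $ v \<noteq> 0"
    using reach[of u v] R01[of u v] Z01[of u v] by (auto simp: A_def)
  then show ?thesis
  proof cases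
    case 1
    then have "mat 1 $ u $ v = (1::real)" by (simp add: mat_def)
    then show ?thesis using nonneg by linarith
  next
    case 4
    have A: "nat_matrix A" unfolding A_def by (intro nat_matrices)
    have "(A ** A) $ u $ v + (A ** A ** A) $ u $ v \<ge> 1"
      using 4(4) nat_matrix_ge_1[of "A ** A" u v] nat_matrix_ge_1[of "A ** A ** A" u v]
        nat_matrix_nonneg[of "A ** A" u v] nat_matrix_nonneg[of "A ** A ** A" u v] A
      by (fastforce intro: nat_matrix_mult)
    then show ?thesis using 4(1-3) by (simp add: N_def mat_def)
  qed (use nonneg in linarith)+
qed

lemma A_ones: "A ** all_ones = (real r + real z) *\<^sub>R all_ones"
  and ones_A: "all_ones ** A = (real r + real z) *\<^sub>R all_ones"
  by (simp_all add: A_def matrix_ring R_ones ones_R Z_ones ones_Z algebra_simps)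

lemma P_ones: "P ** all_ones = all_ones" and ones_P: "all_ones ** P = all_ones"
proof -
  let ?d = "real r + real z"
  have d: "(1 - real r) + (1 - 2 * real r) * ?d + real r + ?d * ?d + ?d * ?d * ?d - real CARD('v) = 1"
    by (simp add: card power2_eq_square power3_eq_cube algebra_simps)
  have "A ** A ** all_ones = (?d * ?d) *\<^sub>R all_ones"
    "A ** A ** A ** all_ones = (?d * ?d * ?d) *\<^sub>R all_ones"
    by (simp_all only: matrix_mul_assoc[symmetric] A_ones matrix_scaleR_right scaleR_scaleR mult.assoc)
  then have "P ** all_ones = ((1 - real r) + (1 - 2 * real r) * ?d + real r + ?d * ?d + ?d * ?d * ?d
      - real CARD('v)) *\<^sub>R all_ones"
    by (simp only: P_def N_def matrix_add_rdistrib matrix_diff_rdistrib matrix_scaleR_left A_ones R_ones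
        all_ones_mult_all_ones matrix_mul_lid scaleR_scaleR) (simp add: vec_eq_iff)
  then show "P ** all_ones = all_ones" unfolding d by simp
  have "all_ones ** (A ** A) = (?d * ?d) *\<^sub>R all_ones"
    "all_ones ** (A ** A ** A) = (?d * ?d * ?d) *\<^sub>R all_ones"
    by (simp_all only: matrix_mul_assoc ones_A matrix_scaleR_left scaleR_scaleR)
  then have "all_ones ** P = ((1 - real r) + (1 - 2 * real r) * ?d + real r + ?d * ?d + ?d * ?d * ?d
      - real CARD('v)) *\<^sub>R all_ones"
    by (simp only: P_def N_def matrix_add_ldistrib matrix_diff_ldistrib matrix_scaleR_right ones_A ones_R
        all_ones_mult_all_ones matrix_mul_rid scaleR_scaleR) (simp add: vec_eq_iff)
  then show "all_ones ** P = all_ones" unfolding d by simp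
qed

lemma nat_P: "nat_matrix P"
  unfolding nat_matrix_def
proof (intro allI)
  fix u v
  obtain k where k: "N $ u $ v = real k" using nat_N unfolding nat_matrix_def by (metis Nats_cases)
  then have "P $ u $ v = real (k - 1)" using N_ge_1[of u v] by (simp add: P_def all_ones_def of_nat_diff)
  then show "P $ u $ v \<in> \<nat>" by simp
qed

lemma P_row_sum: "(\<Sum>v\<in>UNIV. P $ u $ v) = 1" and P_col_sum: "(\<Sum>v\<in>UNIV. P $ v $ u) = 1"
  using arg_cong[OF P_ones, of "\<lambda>M. M $ u $ u"] arg_cong[OF ones_P, of "\<lambda>M. M $ u $ u"]
  by (simp_all only: mult_all_ones_nth all_ones_mult_nth) (simp_all add: all_ones_def)

definition "\<sigma> u = (SOME v. P $ u $ v \<noteq> 0)"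

text \<open>A row of nonnegative integers with sum one has a single nonzero entry, and this entry is
  one.\<close>

lemma P_nth: "P $ u $ v = (if v = \<sigma> u then 1 else 0)"
proof -
  have "\<exists>v. P $ u $ v \<noteq> 0"
    using P_row_sum[of u] by (metis sum.neutral zero_neq_one)
  then have "P $ u $ \<sigma> u \<noteq> 0" unfolding \<sigma>_def by (rule someI_ex)
  then have ge: "P $ u $ \<sigma> u \<ge> 1" using nat_matrix_ge_1[OF nat_P] by simp
  have eq: "P $ u $ \<sigma> u + (\<Sum>v\<in>UNIV - {\<sigma> u}. P $ u $ v) = 1"
    using P_row_sum[of u] by (simp add: sum.remove[of UNIV "\<sigma> u"])
  have nonneg: "(\<Sum>v\<in>UNIV - {\<sigma> u}. P $ u $ v) \<ge> 0"
    by (simp add: sum_nonneg nat_matrix_nonneg nat_P)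
  have "v \<noteq> \<sigma> u \<Longrightarrow> P $ u $ v \<le> (\<Sum>v\<in>UNIV - {\<sigma> u}. P $ u $ v)"
    by (rule member_le_sum) (auto simp: nat_matrix_nonneg nat_P)
  then show ?thesis
    using ge eq nonneg nat_matrix_nonneg[OF nat_P, of u v] by force
qed

lemma inj_\<sigma>: "inj \<sigma>"
proof (rule injI, rule ccontr)
  fix u v assume "\<sigma> u = \<sigma> v" "u \<noteq> v"
  then have "(\<Sum>x\<in>{u, v}. P $ x $ \<sigma> u) = 2" by (simp add: P_nth)
  moreover have "(\<Sum>x\<in>{u, v}. P $ x $ \<sigma> u) \<le> (\<Sum>x\<in>UNIV. P $ x $ \<sigma> u)"
    by (rule sum_mono2) (simp_all add: nat_matrix_nonneg nat_P)
  ultimately show False using P_col_sum[of "\<sigma> u"] by simp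
qed

lemma bij_\<sigma>: "bij \<sigma>"
  using inj_\<sigma> by (simp add: bij_def finite_UNIV_inj_surj)

lemma permutation_matrix_P: "permutation_matrix P"
  unfolding permutation_matrix_def P_nth using bij_\<sigma> by (auto simp: bij_def inj_def surj_def)

lemma N_eq: "N $ u $ w = (if w = \<sigma> u then 2 else 1)"
  using P_nth[of u w] by (simp add: P_def all_ones_def split: if_splits)

text \<open>Apart from the summand \<open>R\<close>, \<open>N\<close> is a polynomial in
  \<open>A\<close>, so its commutator with \<open>A\<close> is that of \<open>R\<close>. On the
  other hand N = J + P, and J commutes with \<open>A\<close> by regularity.\<close>

lemma commutator: "R ** Z + A ** P = Z ** R + P ** A"
proof -
  have N: "N = all_ones + P" by (simp add: P_def)
  have "N ** A - A ** N = R ** A - A ** R"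
    by (simp add: N_def matrix_ring)
  moreover have "R ** A - A ** R = R ** Z - Z ** R"
    by (simp add: A_def matrix_ring)
  moreover have "N ** A - A ** N = P ** A - A ** P"
    by (simp add: N matrix_ring A_ones ones_A)
  ultimately have "P ** A - A ** P = R ** Z - Z ** R" by simp
  then show ?thesis by (simp add: algebra_simps)
qed

lemma P_A_nth: "(P ** M) $ u $ w = M $ \<sigma> u $ w"
  by (simp add: matrix_mult_nth P_nth if_distrib[of "\<lambda>x. x * _"] sum.delta cong: if_cong)

lemma A_P_nth: "(M ** P) $ u $ \<sigma> w = M $ u $ w"
proof -
  have "P $ v $ \<sigma> w = (if v = w then 1 else 0)" for v
    using inj_\<sigma> by (auto simp: P_nth inj_def)
  then show ?thesis
    by (simp add: matrix_mult_nth if_distrib[of "\<lambda>x. _ * x"] cong: if_cong)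
qed

lemma edge_arc_not_commute: "R ** Z \<noteq> Z ** R"
proof
  assume comm: "R ** Z = Z ** R"
  fix u
  obtain x y w where "R $ u $ x = 1" "Z $ x $ y = 1" "Z $ y $ w = 1"
    using R_neighbour Z_neighbour by metis
  then have "(R ** Z) $ u $ y \<ge> 1"
    using matrix_mult_nth_ge[OF nat_R nat_Z, of u x y] by simp
  then have ge: "(R ** Z ** Z) $ u $ w \<ge> 1"
    using matrix_mult_nth_ge[of "R ** Z" Z u y w] \<open>Z $ y $ w = 1\<close> by (simp add: nat_matrices)
  have "Z ** R ** Z = R ** Z ** Z" by (simp add: comm)
  moreover have "Z ** Z ** R = R ** Z ** Z"
    by (metis comm matrix_mul_assoc)
  ultimately have "(Z ** R ** Z) $ u $ w \<ge> 1" "(Z ** Z ** R) $ u $ w \<ge> 1" using ge by simp_all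
  then have "N $ u $ w \<ge> 3"
    using ge walks_nonneg[of u w] N_nth[of u w] by linarith
  then show False by (simp add: N_eq split: if_splits)
qed

subsection \<open>The undirected degree\<close>

lemma commutator_nth:
  "(R ** Z) $ u $ w + (A ** P) $ u $ w = (Z ** R) $ u $ w + A $ \<sigma> u $ w"
  using arg_cong[OF commutator, of "\<lambda>M. M $ u $ w"] by (simp add: P_A_nth)

lemma nat_A: "nat_matrix A"
  unfolding A_def by (intro nat_matrices)

text \<open>These serve the counting arguments below: walks of two kinds from u to w locate w at
  \<sigma> u, and a third walk is a contradiction.\<close>

lemma two_walks: "N $ u $ w \<ge> 2 \<Longrightarrow> w = \<sigma> u" and less_three_walks: "N $ u $ w < 3"
  by (auto simp: N_eq split: if_splits)

lemma RZ_ge_1: "R $ u $ v = 1 \<Longrightarrow> Z $ v $ w = 1 \<Longrightarrow> (R ** Z) $ u $ w \<ge> 1"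
  using matrix_mult_nth_ge[OF nat_R nat_Z, of u v w] by simp

lemma ZR_ge_1: "Z $ u $ v = 1 \<Longrightarrow> R $ v $ w = 1 \<Longrightarrow> (Z ** R) $ u $ w \<ge> 1"
  using matrix_mult_nth_ge[OF nat_Z nat_R, of u v w] by simp

lemma RZ_ge_2:
  "R $ u $ v = 1 \<Longrightarrow> Z $ v $ w = 1 \<Longrightarrow> R $ u $ v' = 1 \<Longrightarrow> Z $ v' $ w = 1 \<Longrightarrow> v \<noteq> v'
    \<Longrightarrow> (R ** Z) $ u $ w \<ge> 2"
  using matrix_mult_nth_ge2[OF nat_R nat_Z, of v v' u w] by simp

lemma other_R_neighbour:
  assumes "r \<ge> 2"
  obtains v where "v \<noteq> x" "R $ u $ v = 1"
proof -
  have "\<exists>v. v \<noteq> x \<and> R $ u $ v \<noteq> 0"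
  proof (rule ccontr)
    assume "\<nexists>v. v \<noteq> x \<and> R $ u $ v \<noteq> 0"
    then have "(\<Sum>v\<in>UNIV. R $ u $ v) = R $ u $ x"
      by (subst sum.mono_neutral_right[of UNIV "{x}"]) auto
    also have "\<dots> \<le> 1" using R01[of u x] by auto
    finally show False unfolding R_row_sum using assms by simp
  qed
  then show thesis using that R01 by blast
qed

text \<open>If u is joined to \<sigma> u, take another neighbour x of u and an arc from x to y.
  Counting walks excludes \<open>Z ** R\<close> at (u, y), so \<open>commutator\<close> makes
  \<sigma> u adjacent to y. If by an edge, x reaches \<sigma> u both through y and through u, whence
  \<sigma> x = \<sigma> u. If by an arc, u reaches y through both x and \<sigma> u, whence y =
  \<sigma> u and the arc is a loop.\<close>

lemma not_edge_\<sigma>: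
  assumes "r \<ge> 2"
  shows "R $ u $ \<sigma> u = 0"
proof (rule ccontr)
  assume "R $ u $ \<sigma> u \<noteq> 0"
  then have e: "R $ u $ \<sigma> u = 1" using R01[of u "\<sigma> u"] by auto
  obtain x where x: "x \<noteq> \<sigma> u" "R $ u $ x = 1" using other_R_neighbour[OF assms] .
  obtain y where y: "Z $ x $ y = 1" using Z_neighbour by blast
  have RZ: "(R ** Z) $ u $ y \<ge> 1" using RZ_ge_1 x y by blast
  have "(Z ** R) $ u $ y = 0"
  proof (rule ccontr)
    assume "(Z ** R) $ u $ y \<noteq> 0"
    then have ZR: "(Z ** R) $ u $ y \<ge> 1" by (simp add: nat_matrix_ge_1 nat_matrices)
    note N = N_nth[of u y] walks_nonneg[of u y]
    have "N $ u $ y \<ge> 2" using RZ ZR N by linarith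
    then have "y = \<sigma> u" by (rule two_walks)
    then have "N $ u $ y \<ge> 3" using RZ ZR N e by auto
    then show False using less_three_walks[of u y] by simp
  qed
  then have "A $ \<sigma> u $ y \<ge> 1"
    using commutator_nth[of u y] RZ nat_matrix_nonneg[of "A ** P" u y] nat_A nat_P
    by (simp add: nat_matrix_mult)
  then consider "R $ \<sigma> u $ y = 1" | "Z $ \<sigma> u $ y = 1"
    using R01[of "\<sigma> u" y] Z01[of "\<sigma> u" y] by (auto simp: A_def)
  then show False
  proof cases
    case 1
    then have "(Z ** R) $ x $ \<sigma> u \<ge> 1" using ZR_ge_1 y R_sym by metis
    moreover have "S $ x $ \<sigma> u \<ge> 1" using S_ge_1 x e R_sym by metis
    ultimately have "N $ x $ \<sigma> u \<ge> 2" using N_nth[of x "\<sigma> u"] walks_nonneg[of x "\<sigma> u"] by linarith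
    then have "\<sigma> u = \<sigma> x" by (rule two_walks)
    then have "u = x" using inj_\<sigma> by (simp add: inj_def)
    then show False using x R_diag by simp
  next
    case 2
    then have "(R ** Z) $ u $ y \<ge> 2" using RZ_ge_2 x y e by blast
    then have "N $ u $ y \<ge> 2" using N_nth[of u y] walks_nonneg[of u y] by linarith
    then have "y = \<sigma> u" by (rule two_walks)
    then show False using 2 Z_diag by simp
  qed
qed

text \<open>Otherwise w = \<sigma> u, and the two walks exhaust \<open>N\<close> there. A second
  edge at u followed by an arc leads to some w' other than w, and \<open>commutator\<close> makes w
  adjacent to w'. An edge yields a third walk from u to w, an arc a second walk from u to
  w'.\<close>

lemma no_RZ_and_ZR:
  assumes "r \<ge> 2"
  shows "(R ** Z) $ u $ w = 0 \<or> (Z ** R) $ u $ w = 0"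
proof (rule ccontr)
  assume "\<not> ?thesis"
  then have neq: "(R ** Z) $ u $ w \<noteq> 0" "(Z ** R) $ u $ w \<noteq> 0" by auto
  then have ge: "(R ** Z) $ u $ w \<ge> 1" "(Z ** R) $ u $ w \<ge> 1"
    by (simp_all add: nat_matrix_ge_1 nat_matrices)
  note N = N_nth[of u w] walks_nonneg[of u w] less_three_walks[of u w]
  have "N $ u $ w \<ge> 2" using ge N by linarith
  then have w: "w = \<sigma> u" by (rule two_walks)
  obtain x where "R $ u $ x \<noteq> 0" "Z $ x $ w \<noteq> 0" using matrix_mult_nth_neq_0E[OF neq(1)] .
  then have x: "R $ u $ x = 1" "Z $ x $ w = 1" using R01 Z01 by blast+
  obtain x' where x': "x' \<noteq> x" "R $ u $ x' = 1" using other_R_neighbour[OF assms] .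
  obtain w' where w': "Z $ x' $ w' = 1" using Z_neighbour by blast
  have "w' \<noteq> w"
  proof
    assume "w' = w"
    then have "(R ** Z) $ u $ w \<ge> 2" using RZ_ge_2 x x' w' by blast
    then show False using ge N by linarith
  qed
  note N' = N_nth[of u w'] walks_nonneg[of u w']
  have RZ: "(R ** Z) $ u $ w' \<ge> 1" using RZ_ge_1 x' w' by blast
  have "(Z ** R) $ u $ w' = 0"
  proof (rule ccontr)
    assume "(Z ** R) $ u $ w' \<noteq> 0"
    then have "(Z ** R) $ u $ w' \<ge> 1" by (simp add: nat_matrix_ge_1 nat_matrices)
    then have "N $ u $ w' \<ge> 2" using RZ N' by linarith
    then show False using two_walks \<open>w' \<noteq> w\<close> w by blast
  qed
  then have "A $ w $ w' \<ge> 1"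
    using commutator_nth[of u w'] RZ nat_matrix_nonneg[of "A ** P" u w'] nat_A nat_P
    by (simp add: nat_matrix_mult w)
  then consider "R $ w $ w' = 1" | "Z $ w $ w' = 1"
    using R01[of w w'] Z01[of w w'] by (auto simp: A_def)
  then show False
  proof cases
    case 1
    have "(R ** Z) $ u $ w' * R $ w' $ w \<le> (R ** Z ** R) $ u $ w"
      by (intro matrix_mult_nth_ge nat_matrices)
    then have "(R ** Z ** R) $ u $ w \<ge> 1" using RZ 1 R_sym[of w w'] by simp
    then show False using ge N by linarith
  next
    case 2
    have "(R ** Z) $ u $ w * Z $ w $ w' \<le> (R ** Z ** Z) $ u $ w'"
      by (intro matrix_mult_nth_ge nat_matrices)
    then have "(R ** Z ** Z) $ u $ w' \<ge> 1" using ge 2 by simp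
    then have "N $ u $ w' \<ge> 2" using RZ N' by linarith
    then show False using two_walks \<open>w' \<noteq> w\<close> w by blast
  qed
qed

text \<open>Where \<open>R ** Z\<close> is nonzero, \<open>Z ** R\<close> vanishes, and
  \<open>commutator\<close> reads RZ + AP = PA.\<close>

lemma RZ_le_PA:
  assumes "r \<ge> 2"
  shows "(R ** Z) $ u $ w \<le> A $ \<sigma> u $ w"
  using no_RZ_and_ZR[OF assms, of u w] commutator_nth[of u w] nat_matrix_nonneg[of "A ** P" u w]
    nat_matrix_nonneg[of A "\<sigma> u" w] nat_A nat_P by (auto simp: nat_matrix_mult)

lemma ZR_le_AP:
  assumes "r \<ge> 2"
  shows "(Z ** R) $ u $ w \<le> (A ** P) $ u $ w"
  using no_RZ_and_ZR[OF assms, of u w] commutator_nth[of u w] nat_matrix_nonneg[of "A ** P" u w]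
    nat_matrix_nonneg[of A "\<sigma> u" w] nat_A nat_P by (auto simp: nat_matrix_mult)

lemma Z_unique_target:
  assumes "z = 1" "Z $ u $ v = 1" "Z $ u $ w = 1"
  shows "v = w"
proof (rule ccontr)
  assume "v \<noteq> w"
  then have "2 = (\<Sum>x\<in>{v, w}. Z $ u $ x)" using assms by simp
  also have "\<dots> \<le> (\<Sum>x\<in>UNIV. Z $ u $ x)"
    by (rule sum_mono2) (simp_all add: nat_matrix_nonneg nat_Z)
  also have "\<dots> = 1" using assms(1) by (simp only: Z_row_sum)
  finally show False by simp
qed

lemma Z_unique_source:
  assumes "z = 1" "Z $ v $ u = 1" "Z $ w $ u = 1"
  shows "v = w"
proof (rule ccontr)
  assume "v \<noteq> w"
  then have "2 = (\<Sum>x\<in>{v, w}. Z $ x $ u)" using assms by simp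
  also have "\<dots> \<le> (\<Sum>x\<in>UNIV. Z $ x $ u)"
    by (rule sum_mono2) (simp_all add: nat_matrix_nonneg nat_Z)
  also have "\<dots> = 1"
    using assms(1) arg_cong[OF ones_Z, of "\<lambda>M. M $ u $ u"] by (simp only: all_ones_mult_nth) simp
  finally show False by simp
qed

lemma RZ_ones: "R ** Z ** all_ones = (real r * real z) *\<^sub>R all_ones"
  and ZR_ones: "Z ** R ** all_ones = (real r * real z) *\<^sub>R all_ones"
  by (simp_all only: matrix_mul_assoc[symmetric] R_ones Z_ones matrix_scaleR_right scaleR_scaleR
      mult.commute)

text \<open>As arcs have unique sources and targets, \<open>not_edge_\<sigma>\<close> sharpens the
  two bounds to RZ <= PR and ZR <= RP. All row sums are r, so equality holds, and R(RZ) = RPR =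
  (ZR)R.\<close>

lemma R_sq_Z_eq_z1:
  assumes "r \<ge> 2" "z = 1"
  shows "R ** R ** Z = Z ** R ** R"
proof -
  have RZ: "R ** Z = P ** R"
  proof (rule matrix_eq_of_le_of_row_sums)
    fix u w
    show "(R ** Z) $ u $ w \<le> (P ** R) $ u $ w"
    proof (cases "(R ** Z) $ u $ w = 0")
      case True
      then show ?thesis by (simp add: nat_matrix_nonneg nat_matrices nat_P)
    next
      case False
      then obtain x where "R $ u $ x \<noteq> 0" "Z $ x $ w \<noteq> 0" by (rule matrix_mult_nth_neq_0E)
      then have x: "R $ u $ x = 1" "Z $ x $ w = 1" using R01 Z01 by blast+
      have "Z $ \<sigma> u $ w \<noteq> 1"
      proof
        assume "Z $ \<sigma> u $ w = 1"
        then have "x = \<sigma> u" using Z_unique_source assms(2) x(2) by blast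
        then show False using x not_edge_\<sigma>[OF assms(1), of u] by simp
      qed
      then have "A $ \<sigma> u $ w = R $ \<sigma> u $ w" using Z01[of "\<sigma> u" w] by (auto simp: A_def)
      then show ?thesis using RZ_le_PA[OF assms(1), of u w] by (simp add: P_A_nth)
    qed
  next
    show "R ** Z ** all_ones = P ** R ** all_ones"
      using assms(2) RZ_ones by (simp add: R_ones P_ones matrix_scaleR_right flip: matrix_mul_assoc)
  qed
  have ZR: "Z ** R = R ** P"
  proof (rule matrix_eq_of_le_of_row_sums)
    fix u w
    show "(Z ** R) $ u $ w \<le> (R ** P) $ u $ w"
    proof (cases "(Z ** R) $ u $ w = 0")
      case True
      then show ?thesis by (simp add: nat_matrix_nonneg nat_matrices nat_P)
    next
      case False
      then obtain y where "Z $ u $ y \<noteq> 0" "R $ y $ w \<noteq> 0" by (rule matrix_mult_nth_neq_0E)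
      then have y: "Z $ u $ y = 1" "R $ y $ w = 1" using R01 Z01 by blast+
      obtain p where p: "w = \<sigma> p" using bij_\<sigma> by (metis bij_pointE)
      have "Z $ u $ p \<noteq> 1"
      proof
        assume "Z $ u $ p = 1"
        then have "y = p" using Z_unique_target assms(2) y(1) by blast
        then show False using y p not_edge_\<sigma>[OF assms(1), of p] by simp
      qed
      then have "A $ u $ p = R $ u $ p" using Z01[of u p] by (auto simp: A_def)
      then show ?thesis using ZR_le_AP[OF assms(1), of u w] by (simp add: p A_P_nth)
    qed
  next
    show "Z ** R ** all_ones = R ** P ** all_ones"
      using assms(2) ZR_ones by (simp add: R_ones P_ones flip: matrix_mul_assoc)
  qed
  have "R ** (R ** Z) = Z ** R ** R" by (simp only: RZ ZR matrix_mul_assoc)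
  then show ?thesis by (simp only: matrix_mul_assoc)
qed

text \<open>Row u of \<open>R ** Z\<close> has sum rz. By \<open>RZ_le_PA\<close> each end w of such
  a walk is adjacent from \<sigma> u. Edges continue the walk to an edge-arc-edge walk from u to
  \<sigma> u, of which there are at most two; arcs account for at most z. Hence rz <= 2 + z.\<close>

lemma r2_z2:
  assumes "r \<ge> 2" "z \<ge> 2"
  shows "r = 2 \<and> z = 2"
proof -
  fix u
  have le: "(R ** Z) $ u $ w \<le> (R ** Z) $ u $ w * R $ w $ \<sigma> u + Z $ \<sigma> u $ w" for w
    using R01[of w "\<sigma> u"] R_sym[of w "\<sigma> u"] Z01[of "\<sigma> u" w] RZ_le_PA[OF assms(1), of u w]
    by (auto simp: A_def)
  have "real r * real z = (R ** Z ** all_ones) $ u $ u"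
    by (simp add: RZ_ones)
  also have "\<dots> = (\<Sum>w\<in>UNIV. (R ** Z) $ u $ w)"
    by (rule mult_all_ones_nth)
  also have "\<dots> \<le> (\<Sum>w\<in>UNIV. (R ** Z) $ u $ w * R $ w $ \<sigma> u + Z $ \<sigma> u $ w)"
    by (rule sum_mono) (rule le)
  also have "\<dots> = (R ** Z ** R) $ u $ \<sigma> u + real z"
    by (simp only: sum.distrib Z_row_sum matrix_mult_nth[of "R ** Z" R])
  also have "(R ** Z ** R) $ u $ \<sigma> u \<le> 2"
    using N_nth[of u "\<sigma> u"] walks_nonneg[of u "\<sigma> u"] N_eq[of u "\<sigma> u"] by simp
  finally have "real (r * z) \<le> real (2 + z)" by simp
  then have le: "r * z \<le> 2 + z" by linarith
  have "\<not> r \<ge> 3"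
  proof
    assume "r \<ge> 3"
    then have "3 * z \<le> r * z" by simp
    then show False using le assms(2) by linarith
  qed
  then have "r = 2" using assms(1) by simp
  then show ?thesis using le assms(2) by simp
qed

text \<open>Now rz = r + z, so the row sums turn both bounds into equalities. Then A(RZ) = APA =
  (ZR)A, and the common term ZRZ cancels.\<close>

lemma R_sq_Z_eq_z2:
  assumes "r \<ge> 2" "z \<ge> 2"
  shows "R ** R ** Z = Z ** R ** R"
proof -
  have rz: "real r = 2" "real z = 2" using r2_z2[OF assms] by simp_all
  have RZ: "R ** Z = P ** A"
  proof (rule matrix_eq_of_le_of_row_sums)
    show "(R ** Z) $ u $ w \<le> (P ** A) $ u $ w" for u w
      using RZ_le_PA[OF assms(1)] by (simp add: P_A_nth)
    show "R ** Z ** all_ones = P ** A ** all_ones"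
      by (simp add: RZ_ones) (simp add: A_ones P_ones matrix_scaleR_right rz flip: matrix_mul_assoc)
  qed
  have ZR: "Z ** R = A ** P"
  proof (rule matrix_eq_of_le_of_row_sums)
    show "(Z ** R) $ u $ w \<le> (A ** P) $ u $ w" for u w
      using ZR_le_AP[OF assms(1)] by simp
    show "Z ** R ** all_ones = A ** P ** all_ones"
      by (simp add: ZR_ones) (simp add: A_ones P_ones matrix_scaleR_right rz flip: matrix_mul_assoc)
  qed
  have "A ** (R ** Z) = Z ** R ** A" by (simp only: RZ ZR matrix_mul_assoc)
  then show ?thesis by (simp add: A_def matrix_ring)
qed

lemma r_eq_1: "r = 1"
proof (rule ccontr)
  assume "r \<noteq> 1"
  then have r2: "r \<ge> 2" using r by simp
  have "R ** R ** Z = Z ** R ** R"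
    using R_sq_Z_eq_z1[OF r2] R_sq_Z_eq_z2[OF r2] z by (cases "z = 1") auto
  then have SZ: "S ** Z = Z ** S" by (simp add: S_def matrix_ring)
  fix u
  \<comment> \<open>Every walk counted by \<open>S ** Z\<close> has a companion counted by
    \<open>Z ** S\<close>, so it uses up the whole excess of \<open>N\<close>. Row sums then give
    r(r - 1)z <= 1.\<close>
  have le: "(S ** Z) $ u $ w \<le> P $ u $ w" for w
  proof (cases "(S ** Z) $ u $ w = 0")
    case True
    then show ?thesis by (simp add: nat_matrix_nonneg nat_P)
  next
    case False
    then have "(S ** Z) $ u $ w \<ge> 1" by (simp add: nat_matrix_ge_1 nat_matrices)
    moreover have "2 * (S ** Z) $ u $ w \<le> N $ u $ w"
      using N_nth[of u w] walks_nonneg[of u w] unfolding SZ by linarith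
    ultimately show ?thesis using N_eq[of u w] P_nth[of u w] by (auto split: if_splits)
  qed
  have "R ** R ** all_ones = (real r * real r) *\<^sub>R all_ones"
    by (simp only: matrix_mul_assoc[symmetric] R_ones matrix_scaleR_right scaleR_scaleR)
  then have "S ** all_ones = (real r * real r - real r) *\<^sub>R all_ones"
    by (simp only: S_def matrix_diff_rdistrib matrix_scaleR_left matrix_mul_lid scaleR_diff_left)
  then have "S ** Z ** all_ones = ((real r * real r - real r) * real z) *\<^sub>R all_ones"
    by (simp only: matrix_mul_assoc[symmetric] Z_ones matrix_scaleR_right scaleR_scaleR mult.commute)
  then have "(real r * real r - real r) * real z = (S ** Z ** all_ones) $ u $ u"
    by simp
  also have "\<dots> = (\<Sum>w\<in>UNIV. (S ** Z) $ u $ w)" by (rule mult_all_ones_nth)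
  also have "\<dots> \<le> (\<Sum>w\<in>UNIV. P $ u $ w)" by (rule sum_mono) (rule le)
  also have "\<dots> = 1" by (rule P_row_sum)
  finally have le1: "real r * (real r - 1) * real z \<le> 1" by (simp add: algebra_simps)
  have "2 * 1 * 1 \<le> real r * (real r - 1) * real z"
    using r2 z by (intro mult_mono) auto
  then show False using le1 by simp
qed

lemma real_r: "real r = 1"
  using r_eq_1 by simp

lemma S_eq_0: "S = 0"
proof -
  have "R ** R ** all_ones = all_ones"
    by (simp only: matrix_mul_assoc[symmetric] R_ones matrix_scaleR_right real_r scaleR_one)
  then have S: "S ** all_ones = 0"
    by (simp only: S_def matrix_diff_rdistrib matrix_scaleR_left matrix_mul_lid real_r scaleR_one diff_self)
  have "0 ** all_ones = S ** all_ones"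
    unfolding S by (simp add: vec_eq_iff matrix_mult_nth)
  then have "0 = S"
    by (rule matrix_eq_of_le_of_row_sums[rotated]) (simp add: nat_matrix_nonneg nat_S)
  then show ?thesis by simp
qed

lemma R_sq: "R ** R = mat 1"
  using S_eq_0 by (simp only: S_def real_r scaleR_one right_minus_eq)

text \<open>For r = 1 the lower terms of \<open>N\<close> collapse to R - A = -Z.\<close>

lemma A_sq_plus_A_cubed: "A ** A + A ** A ** A = all_ones + Z + P"
proof -
  have N: "N + Z = A ** A + A ** A ** A"
    unfolding N_def by (simp add: real_r) (simp add: A_def)
  show ?thesis by (simp add: P_def add.commute flip: N)
qed

end
section \<open>The case \<open>P = R\<close>\<close>

text \<open>Infinite descent: modulo 2 the equation forces both numbers to be even, and it survives
  halving.\<close>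

lemma golden_ratio_irrational:
  fixes x y :: int
  assumes "x * x + x * y = y * y"
  shows "y = 0"
  using assms
proof (induction "nat \<bar>y\<bar>" arbitrary: x y rule: less_induct)
  case less
  have "even (x * x + x * y) \<longleftrightarrow> even (y * y)" using less.prems by simp
  then have "even x \<and> even y" by auto
  then obtain x' y' where xy: "x = 2 * x'" "y = 2 * y'" by (auto elim!: evenE)
  then have "x' * x' + x' * y' = y' * y'" using less.prems by (simp add: algebra_simps)
  then have "y = 0 \<or> y' = 0" using less.hyps[of y' x'] xy(2) by force
  then show ?case using xy(2) by simp
qed

lemma trace_scaleR: "trace (k *\<^sub>R A) = k * trace A" for A :: "real^'n^'n"
  by (simp add: trace_def sum_distrib_left)

lemma real_count_list: "real (count_list xs w) = (\<Sum>x\<leftarrow>xs. if w = x then 1 else 0)"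
  by (induction xs) auto

lemma distinct_of_count_list_le_1: "(\<And>x. count_list xs x \<le> 1) \<Longrightarrow> distinct xs"
proof (induction xs)
  case (Cons a xs)
  have "count_list xs a = 0" using Cons.prems[of a] by simp
  moreover have "count_list xs x \<le> 1" for x
    using Cons.prems[of x] by (simp split: if_splits)
  ultimately show ?case using Cons.IH by (simp add: count_list_0_iff)
qed simp

context almost_moore_matrices
begin

text \<open>On the complement of the all-ones vector the eigenvalues of \<open>A\<close> are \<open>0\<close> and the two roots of
  \<open>x\<^sup>2 + x = 1\<close>. The projection onto one eigenspace has as its trace a natural number, which is
  only possible for \<open>r + z = 2\<close>.\<close>

lemma z_eq_1:
  assumes PR: "P = R"
  shows "z = 1"
proof -
  define d where "d = 1 + real z"
  define n where "n = real CARD('v)"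
  have d: "real r + real z = d" by (simp add: d_def real_r)
  have n: "n = d^3 + d^2 - d"
    unfolding n_def card d by (simp add: real_r)
  have "n > 0" by (simp add: n_def)
  define \<theta> where "\<theta> = (sqrt 5 - 1) / 2"
  have \<theta>: "\<theta> * \<theta> + \<theta> = 1" by (simp add: \<theta>_def field_simps)
  have "\<theta> < 2"
    using real_sqrt_less_mono[of 5 9] by (simp add: \<theta>_def)
  define c where "c = 2 - \<theta>"
  have "c \<noteq> 0" using \<open>\<theta> < 2\<close> by (simp add: c_def)
  have A3: "A ** A ** A = all_ones + A - A ** A"
    using A_sq_plus_A_cubed by (simp add: PR A_def algebra_simps)
  \<comment> \<open>X = A(A + (1 + \<theta>)I) vanishes at the eigenvalues 0 and -1 - \<theta>,
    takes \<theta> to \<open>c\<close>, and takes the eigenvalue \<open>d\<close> of the all-ones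
    vector to \<open>s\<close>.\<close>
  define X where "X = A ** A + (1 + \<theta>) *\<^sub>R A"
  define s where "s = d * d + (1 + \<theta>) * d"
  have Jn: "all_ones ** (all_ones :: real^'v^'v) = n *\<^sub>R all_ones"
    by (simp add: all_ones_mult_all_ones n_def)
  have XJ: "X ** all_ones = s *\<^sub>R all_ones"
  proof -
    have "A ** A ** all_ones = (d * d) *\<^sub>R all_ones"
      by (simp only: matrix_mul_assoc[symmetric] A_ones d matrix_scaleR_right scaleR_scaleR)
    then show ?thesis
      by (simp only: X_def matrix_add_rdistrib matrix_scaleR_left A_ones d s_def scaleR_scaleR)
        (simp add: vec_eq_iff)
  qed
  have JX: "all_ones ** X = s *\<^sub>R all_ones"
  proof -
    have "all_ones ** (A ** A) = (d * d) *\<^sub>R all_ones"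
      by (simp only: matrix_mul_assoc ones_A d matrix_scaleR_left scaleR_scaleR)
    then show ?thesis
      by (simp only: X_def matrix_add_ldistrib matrix_scaleR_right ones_A d s_def scaleR_scaleR)
        (simp add: vec_eq_iff)
  qed
  have AX: "A ** X = all_ones + \<theta> *\<^sub>R X"
  proof -
    have "A ** X = all_ones + A - A ** A + (1 + \<theta>) *\<^sub>R (A ** A)"
      by (simp only: X_def matrix_add_ldistrib matrix_scaleR_right matrix_mul_assoc A3)
    also have "\<dots> = all_ones + (\<theta> * \<theta> + \<theta>) *\<^sub>R A + \<theta> *\<^sub>R (A ** A)"
      unfolding \<theta> by (simp add: scaleR_add_left)
    also have "\<dots> = all_ones + \<theta> *\<^sub>R X"
      by (simp add: X_def scaleR_add_left scaleR_add_right)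
    finally show ?thesis .
  qed
  have XX: "X ** X = c *\<^sub>R X + (d + 1 + 2 * \<theta>) *\<^sub>R all_ones"
  proof -
    have "X ** X = A ** (A ** X) + (1 + \<theta>) *\<^sub>R (A ** X)"
      by (subst (1) X_def) (simp only: matrix_add_rdistrib matrix_scaleR_left matrix_mul_assoc)
    also have "\<dots> = (d + \<theta> + (1 + \<theta>)) *\<^sub>R all_ones + (\<theta> * \<theta> + (1 + \<theta>) * \<theta>) *\<^sub>R X"
      unfolding AX matrix_add_ldistrib matrix_scaleR_right A_ones d
      by (simp add: vec_eq_iff algebra_simps)
    also have "\<theta> * \<theta> + (1 + \<theta>) * \<theta> = c"
      using \<theta> by (simp add: c_def algebra_simps)
    finally show ?thesis by (simp add: vec_eq_iff algebra_simps)
  qed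
  \<comment> \<open>This is \<open>XX\<close> applied to the all-ones vector; it makes the all-ones
    parts cancel in the square of \<open>E\<close>.\<close>
  have key: "s * s = c * s + (d + 1 + 2 * \<theta>) * n"
    unfolding n s_def c_def power2_eq_square power3_eq_cube using \<theta> by algebra
  \<comment> \<open>The projection onto the \<theta>-eigenspace: \<open>X\<close> without its
    all-ones component, scaled by its eigenvalue \<open>c\<close>.\<close>
  define E where "E = (1 / c) *\<^sub>R (X - (s / n) *\<^sub>R all_ones)"
  have "E ** E = (1 / c * (1 / c)) *\<^sub>R (X ** X - (s * s / n) *\<^sub>R all_ones)"
    unfolding E_def using \<open>n > 0\<close>
    by (simp add: matrix_diff_ldistrib matrix_diff_rdistrib matrix_scaleR_left matrix_scaleR_right XJ JX Jn)
  also have "X ** X - (s * s / n) *\<^sub>R all_ones = c *\<^sub>R (X - (s / n) *\<^sub>R all_ones)"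
    using \<open>n > 0\<close> by (simp add: XX key vec_eq_iff field_simps)
  finally have "E ** E = E"
    using \<open>c \<noteq> 0\<close> by (simp add: E_def)
  then have "trace E \<in> \<nat>" by (rule trace_idempotent_Nats)
  then obtain m where m: "trace E = real m" by (auto elim: Nats_cases)
  \<comment> \<open>There are no loops, and since r = 1 the only closed walk of length two at a
    vertex goes back and forth along its edge.\<close>
  have "trace X = n"
  proof -
    have "(R ** Z) $ u $ u = 0" "(Z ** R) $ u $ u = 0" "(Z ** Z) $ u $ u = 0" for u
    proof -
      have "R $ u $ x * Z $ x $ u = 0" "Z $ u $ x * R $ x $ u = 0" "Z $ u $ x * Z $ x $ u = 0" for x
        using Z01[of u x] Z01[of x u] R_Z[of u x] R_Z[of x u] Z_asym[of u x] R_sym[of u x] by auto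
      then show "(R ** Z) $ u $ u = 0" "(Z ** R) $ u $ u = 0" "(Z ** Z) $ u $ u = 0"
        unfolding matrix_mult_nth by (simp_all only: sum.neutral_const)
    qed
    moreover have "A ** A = mat 1 + R ** Z + Z ** R + Z ** Z"
      by (simp add: A_def matrix_ring R_sq)
    ultimately have "(A ** A) $ u $ u = 1" for u by (simp add: mat_def)
    moreover have "A $ u $ u = 0" for u by (simp add: A_def R_diag Z_diag)
    ultimately show ?thesis by (simp add: X_def trace_def n_def)
  qed
  moreover have "trace (all_ones :: real^'v^'v) = n" by (simp add: trace_def n_def)
  ultimately have "real m * c = n - s"
    using m \<open>c \<noteq> 0\<close> \<open>n > 0\<close> by (simp add: E_def trace_scaleR trace_sub field_simps)
  \<comment> \<open>The equation is split into its integral part and its multiple of \<theta>;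
    irrationality will make both vanish.\<close>
  then have lin: "2 * real m - n + d * d + d = \<theta> * (real m - d)"
    by (simp add: c_def s_def algebra_simps)
  define x :: int where "x = 2 * int m - int CARD('v) + (1 + int z) * (1 + int z) + (1 + int z)"
  define y :: int where "y = int m - (1 + int z)"
  have xy: "real_of_int x = \<theta> * real_of_int y"
    using lin by (simp add: x_def y_def n_def d_def)
  then have "real_of_int x * x + real_of_int x * y = (\<theta> * \<theta> + \<theta>) * (real_of_int y * y)"
    by (simp add: algebra_simps)
  then have "real_of_int (x * x + x * y) = real_of_int (y * y)" by (simp add: \<theta>)
  then have "x * x + x * y = y * y" by linarith
  then have "y = 0" by (rule golden_ratio_irrational)
  then have "real m = d" "2 * real m - n + d * d + d = 0"
    using lin by (simp_all add: y_def d_def)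
  then have "d * (d * d - 4) = 0" using n by (simp add: power2_eq_square power3_eq_cube algebra_simps)
  moreover have "d \<noteq> 0" by (simp add: d_def)
  ultimately have "(d - 2) * (d + 2) = 0" by (simp add: algebra_simps)
  then have "d = 2" by (simp add: d_def)
  then show ?thesis by (simp add: d_def)
qed

section \<open>Edges and arcs as permutations of the vertices\<close>

definition "\<tau> u = (SOME v. Z $ u $ v = 1)"

lemma Z_nth:
  assumes "z = 1"
  shows "Z $ u $ v = (if v = \<tau> u then 1 else 0)"
proof -
  have "Z $ u $ \<tau> u = 1" unfolding \<tau>_def using Z_neighbour by (rule someI_ex)
  then show ?thesis using Z_unique_target[OF assms] Z01[of u v] by auto
qed

lemma inj_\<tau>:
  assumes "z = 1"
  shows "inj \<tau>"
  using Z_unique_source[OF assms] Z_nth[OF assms] by (metis injI)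

end

locale almost_moore_fixed = almost_moore_matrices R Z r z
  for R Z :: "real^('v::finite)^'v" and r z :: nat +
  assumes PR: "P = R"
begin

lemma z1: "z = 1"
  using PR by (rule z_eq_1)

lemma R_nth: "R $ u $ v = (if v = \<sigma> u then 1 else 0)"
  using P_nth by (simp add: PR)

lemma \<sigma>_\<sigma> [simp]: "\<sigma> (\<sigma> u) = u"
  using R_sym[of u "\<sigma> u"] by (simp add: R_nth split: if_splits)

lemma \<sigma>_neq: "\<sigma> u \<noteq> u" "u \<noteq> \<sigma> u"
  using R_diag[of u] by (auto simp: R_nth split: if_splits)

lemma \<tau>_neq: "\<tau> u \<noteq> u" "u \<noteq> \<tau> u"
  using Z_diag[of u] by (auto simp: Z_nth[OF z1] split: if_splits)

lemma \<tau>_\<tau>_neq: "\<tau> (\<tau> u) \<noteq> u" "u \<noteq> \<tau> (\<tau> u)"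
  using Z_asym[of u "\<tau> u"] by (auto simp: Z_nth[OF z1] split: if_splits)

lemma \<tau>_neq_\<sigma>: "\<tau> u \<noteq> \<sigma> u" "\<sigma> u \<noteq> \<tau> u"
  using R_Z[of u "\<tau> u"] by (auto simp: Z_nth[OF z1] R_nth split: if_splits)

lemma \<tau>_eq_iff [simp]: "\<tau> u = \<tau> v \<longleftrightarrow> u = v"
  using inj_\<tau>[OF z1] by (simp add: inj_eq)

lemma \<sigma>_eq_iff [simp]: "\<sigma> u = \<sigma> v \<longleftrightarrow> u = v"
  using inj_\<sigma> by (simp add: inj_eq)

text \<open>The ends of all nonbacktracking walks of length at most three from u, except the single
  edge. A list keeps track of repeated ends.\<close>

definition "ends u = [u, \<tau> u, \<tau> (\<sigma> u), \<sigma> (\<tau> u), \<tau> (\<tau> u), \<sigma> (\<tau> (\<sigma> u)), \<tau> (\<tau> (\<sigma> u)), \<tau> (\<sigma> (\<tau> u)),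
  \<sigma> (\<tau> (\<tau> u)), \<tau> (\<tau> (\<tau> u))]"

text \<open>\<open>S\<close> and \<open>T\<close> vanish, so the ten listed walks and the edge make
  up N = J + P. The edge accounts for P = R, which leaves J.\<close>

lemma count_ends: "count_list (ends u) w = 1"
proof -
  have RM: "(R ** M) $ x $ y = M $ \<sigma> x $ y" for M x y
    using P_A_nth[of M x y] by (simp add: PR)
  have ZM: "(Z ** M) $ x $ y = M $ \<tau> x $ y" for M x y
    by (simp add: matrix_mult_nth Z_nth[OF z1] if_distrib[of "\<lambda>x. x * _"] cong: if_cong)
  have Z0: "0 ** Z = 0" "Z ** 0 = 0" by (simp_all add: vec_eq_iff matrix_mult_nth)
  have mat_1: "mat 1 $ x $ y = (if y = x then 1 else 0)" for x y by (simp add: mat_def)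
  have T: "T = 0" by (simp add: T_def S_eq_0 real_r vec_eq_iff matrix_mult_nth)
  have "real (count_list (ends u) w) + (if w = \<sigma> u then 1 else 0) = N $ u $ w"
    unfolding N_nth S_eq_0 T matrix_mul_assoc[symmetric] RM ZM
    unfolding R_nth Z_nth[OF z1] mat_1 real_count_list ends_def
    by (simp add: Z0 split del: if_split)
  also have "\<dots> = 1 + (if w = \<sigma> u then 1 else 0)" by (simp add: N_eq)
  finally show ?thesis by simp
qed

lemma distinct_ends: "distinct (ends u)"
  by (rule distinct_of_count_list_le_1) (simp add: count_ends)

lemma set_ends: "set (ends u) = UNIV"
proof -
  have "w \<in> set (ends u)" for w
    using count_ends[of u w] count_list_0_iff[of "ends u" w] by auto
  then show ?thesis by blast
qed

lemma card_eq_10: "CARD('v) = 10"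
  using distinct_card[OF distinct_ends[of undefined]] set_ends[of undefined] by (simp add: ends_def)

text \<open>\<sigma> u must occur among the ten ends, and every other position contradicts the
  absence of loops, digons and parallel adjacencies, or the distinctness of the ends.\<close>

lemma \<sigma>_cases: "\<tau> (\<sigma> (\<tau> u)) = \<sigma> u \<or> \<tau> (\<tau> (\<tau> u)) = \<sigma> u"
proof -
  have "\<sigma> u \<in> set (ends u)" by (simp add: set_ends)
  moreover have "\<sigma> u \<noteq> \<tau> (\<tau> u)"
  proof
    assume eq: "\<sigma> u = \<tau> (\<tau> u)"
    have "\<tau> (\<sigma> u) \<noteq> \<tau> (\<tau> (\<tau> u))" using distinct_ends[of u] by (simp add: ends_def)
    then show False by (simp add: eq)
  qed
  moreover have "u \<noteq> \<tau> (\<sigma> u)" using \<tau>_neq_\<sigma>[of "\<sigma> u"] by simp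
  ultimately show ?thesis
    using \<sigma>_neq[of u] \<tau>_neq[of u] \<tau>_neq[of "\<sigma> u"] \<tau>_neq_\<sigma>[of u] \<tau>_\<tau>_neq[of u] \<tau>_\<tau>_neq[of "\<sigma> u"]
    by (auto simp: ends_def)
qed

text \<open>Otherwise \<tau> applied three times to u gives \<sigma> u. Then either case of
  \<open>\<sigma>_cases\<close> at \<open>\<tau> (\<tau> u)\<close> makes two entries of
  \<open>ends u\<close> coincide.\<close>

lemma \<tau>_\<sigma>_\<tau>: "\<tau> (\<sigma> (\<tau> u)) = \<sigma> u"
proof (rule ccontr)
  assume "\<tau> (\<sigma> (\<tau> u)) \<noteq> \<sigma> u"
  then have \<tau>3: "\<tau> (\<tau> (\<tau> u)) = \<sigma> u" using \<sigma>_cases by blast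
  have neq: "\<tau> (\<tau> (\<sigma> u)) \<noteq> \<sigma> (\<tau> (\<tau> u))" "\<tau> u \<noteq> \<sigma> (\<tau> (\<tau> u))"
    using distinct_ends[of u] by (simp_all add: ends_def)
  show False
    using \<sigma>_cases[of "\<tau> (\<tau> u)"] neq by (simp add: \<tau>3 del: \<sigma>_eq_iff \<tau>_eq_iff)
qed

lemma \<tau>_5: "\<tau> (\<tau> (\<tau> (\<tau> (\<tau> u)))) = u"
proof -
  have inv: "\<tau> (\<sigma> (\<tau> (\<sigma> u))) = u" by (simp add: \<tau>_\<sigma>_\<tau>)
  have "\<tau> (\<tau> (\<tau> (\<tau> u))) = \<sigma> (\<tau> (\<sigma> u))"
  proof (rule ccontr)
    assume neq: "\<tau> (\<tau> (\<tau> (\<tau> u))) \<noteq> \<sigma> (\<tau> (\<sigma> u))"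
    let ?v = "\<tau> (\<tau> (\<tau> u))"
    have "\<tau> ?v \<in> set (ends u)" by (simp add: set_ends)
    then have "\<tau> ?v \<in> {u, \<tau> u, \<tau> (\<sigma> u), \<sigma> (\<tau> u), \<tau> (\<tau> u), \<tau> (\<tau> (\<sigma> u)), \<tau> (\<sigma> (\<tau> u)),
        \<sigma> (\<tau> (\<tau> u)), ?v}"
      using neq unfolding ends_def by auto
    \<comment> \<open>By \<open>\<tau>_\<sigma>_\<tau>\<close> each candidate is an image under
      \<tau>, so one \<tau> can be cancelled. What \<open>?v\<close> could then equal is another
      entry of \<open>ends u\<close>, or \<sigma> u, or \<open>\<sigma> ?v\<close>, and all of these
      differ from it.\<close>
    also have "\<dots> = {\<tau> (\<sigma> (\<tau> (\<sigma> u))), \<tau> u, \<tau> (\<sigma> u), \<tau> (\<sigma> (\<tau> (\<tau> u))), \<tau> (\<tau> u), \<tau> (\<tau> (\<sigma> u)),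
        \<tau> (\<sigma> (\<tau> u)), \<tau> (\<sigma> ?v), ?v}"
      by (simp add: inv \<tau>_\<sigma>_\<tau>)
    finally have "\<tau> ?v \<in> \<tau> ` {\<sigma> (\<tau> (\<sigma> u)), u, \<sigma> u, \<sigma> (\<tau> (\<tau> u)), \<tau> u, \<tau> (\<sigma> u), \<sigma> (\<tau> u), \<sigma> ?v, \<tau> (\<tau> u)}"
      by (simp only: image_insert image_empty)
    then have "?v \<in> {\<sigma> (\<tau> (\<sigma> u)), u, \<sigma> u, \<sigma> (\<tau> (\<tau> u)), \<tau> u, \<tau> (\<sigma> u), \<sigma> (\<tau> u), \<sigma> ?v, \<tau> (\<tau> u)}"
      by (simp only: inj_image_mem_iff[OF inj_\<tau>[OF z1]])
    moreover have "?v \<noteq> \<sigma> u"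
      using distinct_ends[of u] by (auto simp: ends_def \<tau>_\<sigma>_\<tau> simp del: \<sigma>_eq_iff \<tau>_eq_iff)
    ultimately show False
      using distinct_ends[of u] \<sigma>_neq[of ?v] unfolding ends_def
      by (simp del: \<sigma>_eq_iff \<tau>_eq_iff) metis
  qed
  then show ?thesis by (simp add: inv)
qed

end

section \<open>The dihedral group of order ten\<close>

text \<open>Under \<open>fold\<close> the leftmost letter acts first, so appending a letter to a
  word, which is right multiplication in the group, applies one more map. The inverse letters act by
  f^4 and g, which are the inverse maps once the relations hold.\<close>

fun dihedral_act :: "('v \<Rightarrow> 'v) \<Rightarrow> ('v \<Rightarrow> 'v) \<Rightarrow> dihedral_gen \<times> bool \<Rightarrow> 'v \<Rightarrow> 'v" where
  "dihedral_act f g (Rho, True) v = f v"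
| "dihedral_act f g (Rho, False) v = f (f (f (f v)))"
| "dihedral_act f g (Refl, e) v = g v"

text \<open>The relations satisfied by f and g make the action of words descend to the presented
  group.\<close>

lemma fold_dihedral_act_cong:
  assumes "word_eq (dihedral_relators 5) a b"
    and "\<And>v. f (f (f (f (f v)))) = v" "\<And>v. g (g v) = v" "\<And>v. f (g (f v)) = g v"
  shows "fold (dihedral_act f g) a v = fold (dihedral_act f g) b v"
  using assms(1)
proof (induction arbitrary: v rule: word_eq.induct)
  case (cancel x e)
  then show ?case by (cases x; cases e) (simp_all add: assms(2-4))
next
  case (relator w)
  then show ?case by (auto simp: dihedral_relators_def eval_nat_numeral assms(2-4))
qed auto

section \<open>Normal forms in the presented group\<close>

declare word_eq.trans [trans]

lemma word_eq_cong: "word_eq X a b \<Longrightarrow> word_eq X (p @ a @ q) (p @ b @ q)"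
  by (intro word_eq.append word_eq.refl)

abbreviation "gen_rho \<equiv> (Rho, True)"
abbreviation "gen_s \<equiv> (Refl, True)"
abbreviation "dihedral_eq \<equiv> word_eq (dihedral_relators 5)"

lemma rho_5: "dihedral_eq (replicate 5 gen_rho) []"
  and refl_2: "dihedral_eq [gen_s, gen_s] []"
  and rho_refl_2: "dihedral_eq [gen_rho, gen_s, gen_rho, gen_s] []"
  by (rule word_eq.relator, simp add: dihedral_relators_def)+

lemma rho_inverse: "dihedral_eq [(Rho, False)] (replicate 4 gen_rho)"
proof -
  have "dihedral_eq [(Rho, False)] ([(Rho, False)] @ replicate 5 gen_rho @ [])"
    using word_eq_cong[OF word_eq.sym[OF rho_5], of "[(Rho, False)]" "[]"] by simp
  also have "dihedral_eq \<dots> (replicate 4 gen_rho)"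
    using word_eq_cong[OF word_eq.cancel[of _ Rho False], of _ "[]" "replicate 4 gen_rho"]
    by (simp add: eval_nat_numeral)
  finally show ?thesis .
qed

lemma refl_inverse: "dihedral_eq [(Refl, False)] [gen_s]"
proof -
  have "dihedral_eq [(Refl, False)] ([(Refl, False)] @ [gen_s, gen_s] @ [])"
    using word_eq_cong[OF word_eq.sym[OF refl_2], of "[(Refl, False)]" "[]"] by simp
  also have "dihedral_eq \<dots> [gen_s]"
    using word_eq_cong[OF word_eq.cancel[of _ Refl False], of _ "[]" "[gen_s]"] by simp
  finally show ?thesis .
qed

text \<open>Insert \<rho>^5 in front and s^2 behind; the relator (\<rho> s)^2 then cancels in the
  middle.\<close>

lemma refl_rho: "dihedral_eq [gen_s, gen_rho] (replicate 4 gen_rho @ [gen_s])"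
proof -
  have "dihedral_eq [gen_s, gen_rho] (replicate 5 gen_rho @ [gen_s, gen_rho])"
    using word_eq_cong[OF word_eq.sym[OF rho_5], of "[]" "[gen_s, gen_rho]"] by simp
  also have "dihedral_eq \<dots> (replicate 5 gen_rho @ [gen_s, gen_rho] @ [gen_s, gen_s])"
    using word_eq_cong[OF word_eq.sym[OF refl_2], of "replicate 5 gen_rho @ [gen_s, gen_rho]" "[]"] by simp
  also have "dihedral_eq \<dots> (replicate 4 gen_rho @ [gen_s])"
    using word_eq_cong[OF rho_refl_2, of "replicate 4 gen_rho" "[gen_s]"] by (simp add: eval_nat_numeral)
  finally show ?thesis .
qed

text \<open>The exponent \<open>4 * i\<close> stands for -i; reduction modulo 5 is left to
  \<open>dihedral_normal_form\<close>.\<close>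

lemma refl_rhos: "dihedral_eq (gen_s # replicate i gen_rho) (replicate (4 * i) gen_rho @ [gen_s])"
proof (induction i)
  case 0
  then show ?case by (simp add: word_eq.refl)
next
  case (Suc i)
  have "dihedral_eq (gen_s # replicate (Suc i) gen_rho) ((replicate 4 gen_rho @ [gen_s]) @ replicate i gen_rho)"
    using word_eq_cong[OF refl_rho, of "[]" "replicate i gen_rho"] by simp
  also have "dihedral_eq \<dots> (replicate 4 gen_rho @ replicate (4 * i) gen_rho @ [gen_s])"
    using word_eq_cong[OF Suc.IH, of "replicate 4 gen_rho" "[]"] by simp
  finally show ?case
    by (simp add: replicate_add flip: append_assoc)
qed

lemma dihedral_word: "\<exists>i j. dihedral_eq w (replicate i gen_rho @ replicate j gen_s)"
proof (induction w)
  case Nil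
  then show ?case by (metis append_Nil replicate_0 word_eq.refl)
next
  case (Cons l w)
  then obtain i j where ij: "dihedral_eq w (replicate i gen_rho @ replicate j gen_s)" by blast
  have *: "dihedral_eq (l # w) (p @ replicate i gen_rho @ replicate j gen_s)" if "dihedral_eq [l] p" for p
    using word_eq.append[OF that ij] by simp
  consider "l = gen_rho" | "l = (Rho, False)" | "l = (Refl, True) \<or> l = (Refl, False)"
    by (cases l) (metis dihedral_gen.exhaust)
  then show ?case
  proof cases
    case 1
    then have "dihedral_eq (l # w) (replicate (Suc i) gen_rho @ replicate j gen_s)"
      using *[OF word_eq.refl] by simp
    then show ?thesis by blast
  next
    case 2
    then have "dihedral_eq (l # w) (replicate (4 + i) gen_rho @ replicate j gen_s)"
      using *[of "replicate 4 gen_rho"] rho_inverse by (simp add: replicate_add)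
    then show ?thesis by blast
  next
    case 3
    then have "dihedral_eq [l] [gen_s]" using refl_inverse word_eq.refl by blast
    then have "dihedral_eq (l # w) ([gen_s] @ replicate i gen_rho @ replicate j gen_s)" by (rule *)
    moreover have "dihedral_eq ([gen_s] @ replicate i gen_rho @ replicate j gen_s)
        (replicate (4 * i) gen_rho @ replicate (Suc j) gen_s)"
      using word_eq_cong[OF refl_rhos[of i], of "[]" "replicate j gen_s"] by simp
    ultimately show ?thesis by (blast intro: word_eq.trans)
  qed
qed

lemma replicate_mod:
  assumes "word_eq X (replicate n x) []"
  shows "word_eq X (replicate i x) (replicate (i mod n) x)"
proof -
  have "word_eq X (replicate (n * k + m) x) (replicate m x)" for k m
  proof (induction k)
    case 0
    then show ?case by (simp add: word_eq.refl)
  next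
    case (Suc k)
    have "word_eq X (replicate n x @ replicate (n * k + m) x) ([] @ replicate m x)"
      using assms Suc.IH by (rule word_eq.append)
    then show ?case by (simp add: replicate_add)
  qed
  from this[of "i div n" "i mod n"] show ?thesis by simp
qed

lemma dihedral_normal_form:
  "\<exists>i<5. \<exists>j<2. dihedral_eq w (replicate i gen_rho @ replicate j gen_s)"
proof -
  obtain i j where "dihedral_eq w (replicate i gen_rho @ replicate j gen_s)" using dihedral_word by blast
  moreover have "dihedral_eq (replicate i gen_rho @ replicate j gen_s)
      (replicate (i mod 5) gen_rho @ replicate (j mod 2) gen_s)"
    using rho_5 refl_2 by (intro word_eq.append replicate_mod) (simp_all add: numeral_2_eq_2)
  ultimately have "dihedral_eq w (replicate (i mod 5) gen_rho @ replicate (j mod 2) gen_s)"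
    by (rule word_eq.trans)
  moreover have "i mod 5 < 5" "j mod 2 < 2" by simp_all
  ultimately show ?thesis by blast
qed

text \<open>The matching lower bound comes from the ten vertices in
  \<open>isomorphic_cayley_graph_dihedral\<close>.\<close>

lemma finite_dihedral: "finite (range (word_class (dihedral_relators 5)))"
  and card_dihedral_le: "card (range (word_class (dihedral_relators 5))) \<le> 10"
proof -
  let ?c = "word_class (dihedral_relators 5)"
  let ?B = "(\<lambda>(i, j). ?c (replicate i gen_rho @ replicate j gen_s)) ` ({..<5} \<times> {..<2})"
  have sub: "range ?c \<subseteq> ?B"
  proof (rule image_subsetI)
    fix w
    obtain i j where "i < 5" "j < 2" "?c w = ?c (replicate i gen_rho @ replicate j gen_s)"
      using dihedral_normal_form[of w] by (auto simp: word_class_eq_iff)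
    then show "?c w \<in> ?B" by (intro image_eqI[of _ _ "(i, j)"]) auto
  qed
  show "finite (range ?c)" by (rule finite_subset[OF sub]) simp
  have "card ?B \<le> card ({..<5::nat} \<times> {..<2::nat})" by (rule card_image_le) simp
  then show "card (range ?c) \<le> 10" using card_mono[OF _ sub] by simp
qed

text \<open>A group with at most ten elements that acts transitively on ten points acts regularly.
  Hence vertices correspond to group elements through the base vertex u, and following f or g is
  right multiplication by \<rho> or s.\<close>

lemma isomorphic_cayley_graph_dihedral:
  fixes G :: "('v::finite) mixed_graph" and f g :: "'v \<Rightarrow> 'v"
  assumes wf: "wf_mixed_graph G" and verts: "verts G = UNIV"
    and adj: "\<And>u v. (u, v) \<in> adj G \<longleftrightarrow> v = f u \<or> v = g u"
    and f: "\<And>v. f (f (f (f (f v)))) = v" and g: "\<And>v. g (g v) = v"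
    and fg: "\<And>v. f (g (f v)) = g v"
    and card: "CARD('v) = 10"
    and transitive: "\<And>v. \<exists>w. fold (dihedral_act f g) w u = v"
  shows "isomorphic G (cayley_graph (dihedral_group 5) {dihedral_rho 5, dihedral_s 5})"
proof -
  let ?c = "word_class (dihedral_relators 5)"
  let ?H = "cayley_graph (dihedral_group 5) {dihedral_rho 5, dihedral_s 5}"
  define word where "word v = (SOME w. fold (dihedral_act f g) w u = v)" for v
  define h where "h v = ?c (word v)" for v
  have act: "fold (dihedral_act f g) (word v) u = v" for v
    unfolding word_def using transitive by (rule someI_ex)
  have inj: "inj h"
  proof (rule injI)
    fix v w assume "h v = h w"
    then have "dihedral_eq (word v) (word w)" by (simp add: h_def word_class_eq_iff)
    then have "fold (dihedral_act f g) (word v) u = fold (dihedral_act f g) (word w) u"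
      by (rule fold_dihedral_act_cong) (fact f g fg)+
    then show "v = w" by (simp add: act)
  qed
  have range: "range h = range ?c"
  proof (rule card_seteq[OF finite_dihedral])
    show "range h \<subseteq> range ?c" by (auto simp: h_def)
    show "card (range ?c) \<le> card (range h)"
      using card_dihedral_le card_image[OF inj] card by simp
  qed
  \<comment> \<open>By surjectivity of \<open>h\<close>, the class of a word depends only on where
    the word takes u.\<close>
  have class_eq: "?c w = h (fold (dihedral_act f g) w u)" for w
  proof -
    obtain v where v: "?c w = h v" using range by (metis rangeI rangeE)
    then have "dihedral_eq w (word v)" by (simp add: h_def word_class_eq_iff)
    then have "fold (dihedral_act f g) w u = fold (dihedral_act f g) (word v) u"
      by (rule fold_dihedral_act_cong) (fact f g fg)+
    then show ?thesis by (simp add: v act)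
  qed
  have mult: "h v \<otimes>\<^bsub>dihedral_group 5\<^esub> ?c [l] = h (dihedral_act f g l v)" for v l
  proof -
    have "h v \<otimes>\<^bsub>dihedral_group 5\<^esub> ?c [l] = ?c (word v @ [l])"
      by (simp only: h_def dihedral_group_def presented_group_mult)
    then show ?thesis by (simp add: class_eq act)
  qed
  have carrier: "carrier (dihedral_group 5) = range h"
    by (simp add: range dihedral_group_def presented_group_def)
  have cayley: "(h v, h w) \<in> cayley_adj (dihedral_group 5) {dihedral_rho 5, dihedral_s 5}
      \<longleftrightarrow> (v, w) \<in> adj G" for v w
  proof -
    have "(h v, h w) \<in> cayley_adj (dihedral_group 5) {dihedral_rho 5, dihedral_s 5}
        \<longleftrightarrow> h w = h v \<otimes>\<^bsub>dihedral_group 5\<^esub> ?c [gen_rho] \<or> h w = h v \<otimes>\<^bsub>dihedral_group 5\<^esub> ?c [gen_s]"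
      by (auto simp: cayley_adj_def carrier dihedral_rho_def dihedral_s_def presented_generator_def)
    then show ?thesis by (simp add: mult adj inj_eq[OF inj])
  qed
  have edge: "{v, w} \<in> edges G \<longleftrightarrow> (v, w) \<in> adj G \<and> (w, v) \<in> adj G"
    and arc: "(v, w) \<in> arcs G \<longleftrightarrow> (v, w) \<in> adj G \<and> (w, v) \<notin> adj G" for v w
    using wf by (auto simp: adj_def wf_mixed_graph_def insert_commute)
  have "mixed_graph_iso h G ?H"
    unfolding mixed_graph_iso_def
  proof (intro conjI ballI)
    show "bij_betw h (verts G) (verts ?H)"
      using inj by (simp add: bij_betw_def verts cayley_graph_def carrier)
    show "{h v, h w} \<in> edges ?H \<longleftrightarrow> {v, w} \<in> edges G" for v w
      unfolding edge cayley[symmetric] by (auto simp: cayley_graph_def doubleton_eq_iff)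
    show "(h v, h w) \<in> arcs ?H \<longleftrightarrow> (v, w) \<in> arcs G" for v w
      unfolding arc cayley[symmetric] by (auto simp: cayley_graph_def)
  qed
  then show ?thesis by (auto simp: isomorphic_def)
qed

section \<open>Almost Moore mixed graphs of diameter three\<close>

lemma walk_of_diameter_le:
  assumes "graph_diameter G = enat k" "u \<in> verts G" "v \<in> verts G"
  shows "\<exists>n\<le>k. (u, v) \<in> adj G ^^ n"
proof (rule ccontr)
  assume "\<not> ?thesis"
  then have "enat (Suc k) \<le> distance G u v"
    unfolding distance_def by (auto simp: le_INF_iff not_less_eq_eq)
  also have "\<dots> \<le> graph_diameter G"
    unfolding graph_diameter_def using assms by (intro SUP_upper2[of "(u, v)"]) auto
  finally show False by (simp add: assms(1))
qed

lemma sum_indicator_card: "(\<Sum>v\<in>UNIV. if Q v then 1 else 0) = real (card {v::'a::finite. Q v})"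
  by (simp add: sum.If_cases)

lemma card_edges_at:
  assumes "wf_mixed_graph G"
  shows "card {v. {u, v} \<in> edges G} = card {e \<in> edges G. u \<in> e}"
proof -
  have image: "(\<lambda>v. {u, v}) ` {v. {u, v} \<in> edges G} = {e \<in> edges G. u \<in> e}"
  proof (intro equalityI subsetI)
    fix e assume e: "e \<in> {e \<in> edges G. u \<in> e}"
    then obtain a b where "e = {a, b}" using assms unfolding wf_mixed_graph_def by blast
    then have "e = {u, if u = a then b else a}" using e by auto
    then show "e \<in> (\<lambda>v. {u, v}) ` {v. {u, v} \<in> edges G}"
      using e by (intro image_eqI[of _ _ "if u = a then b else a"]) simp_all
  qed auto
  have "inj_on (\<lambda>v. {u, v}) {v. {u, v} \<in> edges G}"
    by (auto simp: inj_on_def doubleton_eq_iff)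
  from card_image[OF this] show ?thesis by (simp only: image)
qed

lemma edge_matrix_nth:
  "adjacency_matrix (edge_subgraph G) $ u $ v = (if {u, v} \<in> edges G then 1 else 0)"
  by (simp add: adjacency_matrix_def adj_def edge_subgraph_def)

lemma arc_matrix_nth:
  "adjacency_matrix (arc_subgraph G) $ u $ v = (if (u, v) \<in> arcs G then 1 else 0)"
  by (simp add: adjacency_matrix_def adj_def arc_subgraph_def)

lemma almost_moore_matrices_of_graph:
  fixes G :: "('v::finite) mixed_graph"
  assumes verts: "verts G = UNIV" and r: "r \<ge> 1" and z: "z \<ge> 1" and G: "almost_moore r z 3 G"
  shows "almost_moore_matrices (adjacency_matrix (edge_subgraph G)) (adjacency_matrix (arc_subgraph G)) r z"
    (is "almost_moore_matrices ?R ?Z r z")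
proof
  have wf: "wf_mixed_graph G" and reg: "totally_regular r z G" and diam: "graph_diameter G = enat 3"
    and card: "real CARD('v) = moore_bound r z 3 - 1"
    using G verts by (simp_all add: almost_moore_def)
  note nth = edge_matrix_nth arc_matrix_nth
  have arcD: "u \<noteq> v \<and> (v, u) \<notin> arcs G \<and> {u, v} \<notin> edges G" if "(u, v) \<in> arcs G" for u v
    using wf that by (auto simp: wf_mixed_graph_def)
  show "?R $ u $ v \<in> {0, 1}" "?Z $ u $ v \<in> {0, 1}" "?R $ u $ v = ?R $ v $ u" for u v
    by (simp_all add: nth insert_commute)
  show "?R $ u $ u = 0" for u
    using wf by (auto simp: nth wf_mixed_graph_def)
  show "?R $ u $ v = 0" "?Z $ v $ u = 0" if "?Z $ u $ v = 1" for u v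
    using that arcD[of u v] by (auto simp: nth split: if_splits)
  show "?R ** all_ones = real r *\<^sub>R all_ones" "?Z ** all_ones = real z *\<^sub>R all_ones"
    "all_ones ** ?Z = real z *\<^sub>R all_ones"
    using reg card_edges_at[OF wf]
    by (simp_all add: vec_eq_iff mult_all_ones_nth all_ones_mult_nth nth sum_indicator_card
        totally_regular_def verts)
  show "r \<ge> 1" "z \<ge> 1" by fact+
  show "real CARD('v) = (real r + real z) + (real r + real z)^2 + (real r + real z)^3
      - 2 * r * (real r + real z)"
    using card moore_bound_3[OF r z HOL.refl] by simp
  fix u v
  let ?A = "?R + ?Z"
  have A: "?A $ x $ y = 1" if "(x, y) \<in> adj G" for x y
    using that arcD[of x y] by (auto simp: adj_def nth)
  have nat: "nat_matrix ?A"
    by (simp add: nat_matrix_def nth)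
  obtain n where n: "n \<le> 3" "(u, v) \<in> adj G ^^ n"
    using walk_of_diameter_le[OF diam, of u v] by (auto simp: verts)
  consider "n = 0" | "n = 1" | "n = 2" | "n = 3" using n(1) by linarith
  then show "u = v \<or> ?A $ u $ v \<noteq> 0 \<or> (?A ** ?A) $ u $ v \<noteq> 0 \<or> (?A ** ?A ** ?A) $ u $ v \<noteq> 0"
  proof cases
    case 1
    then show ?thesis using n(2) by simp
  next
    case 2
    then show ?thesis using n(2) A[of u v] by simp
  next
    case 3
    then obtain x where "(u, x) \<in> adj G" "(x, v) \<in> adj G"
      using n(2) by (auto simp: numeral_2_eq_2)
    then have "(?A ** ?A) $ u $ v \<ge> 1"
      using matrix_mult_nth_ge[OF nat nat, of u x v] A by simp
    then show ?thesis by auto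
  next
    case 4
    then obtain x y where xy: "(u, x) \<in> adj G" "(x, y) \<in> adj G" "(y, v) \<in> adj G"
      using n(2) by (auto simp: numeral_3_eq_3)
    then have "(?A ** ?A) $ u $ y \<ge> 1"
      using matrix_mult_nth_ge[OF nat nat, of u x y] A by simp
    moreover have "(?A ** ?A) $ u $ y * ?A $ y $ v \<le> (?A ** ?A ** ?A) $ u $ v"
      by (intro matrix_mult_nth_ge nat_matrix_mult nat)
    ultimately have "(?A ** ?A ** ?A) $ u $ v \<ge> 1" using A[OF xy(3)] by simp
    then show ?thesis by auto
  qed
qed

text \<open>Invariance under \<sigma> says that P commutes with \<open>A\<close>, so
  \<open>commutator\<close> would make \<open>R\<close> and \<open>Z\<close> commute.\<close>

lemma (in almost_moore_matrices) not_automorphism_\<sigma>: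
  assumes "\<And>u v. R $ \<sigma> u $ \<sigma> v = R $ u $ v" "\<And>u v. Z $ \<sigma> u $ \<sigma> v = Z $ u $ v"
  shows False
proof -
  have "(R ** Z) $ u $ w = (Z ** R) $ u $ w" for u w
  proof -
    obtain w' where "w = \<sigma> w'" using bij_\<sigma> by (metis bij_pointE)
    then show ?thesis using commutator_nth[of u w] assms by (simp add: A_P_nth) (simp add: A_def)
  qed
  then show False using edge_arc_not_commute by (simp add: vec_eq_iff)
qed

theorem theorem3p2:
  fixes G :: "('v::finite) mixed_graph" and r z :: nat and A R Z :: "real^'v^'v"
  assumes verts: "verts G = UNIV"
    and r: "r \<ge> 1" and z: "z \<ge> 1"
    and almost_moore: "almost_moore r z 3 G"
    and A: "A = adjacency_matrix G"
    and R: "R = adjacency_matrix (edge_subgraph G)"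
    and Z: "Z = adjacency_matrix (arc_subgraph G)"
  shows "\<exists>P :: real^'v^'v.
           permutation_matrix P \<and>
           A ** A + A ** A ** A = all_ones + Z + P \<and>
           (\<forall>\<sigma>. (\<forall>u v. P $ u $ v = 1 \<longleftrightarrow> \<sigma> u = v) \<longrightarrow> \<not> automorphism G \<sigma>) \<and>
           (P = R \<longrightarrow>
              isomorphic G (cayley_graph (dihedral_group 5) {dihedral_rho 5, dihedral_s 5}))"
proof -
  interpret M: almost_moore_matrices R Z r z
    unfolding R Z by (rule almost_moore_matrices_of_graph) fact+
  have wf: "wf_mixed_graph G" using almost_moore by (simp add: almost_moore_def)
  have A_eq: "A = M.A"
    unfolding M.A_def unfolding A R Z by (rule adjacency_matrix_decomp[OF wf])
  show ?thesis
  proof (intro exI[of _ M.P] conjI allI impI)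
    show "permutation_matrix M.P" by (rule M.permutation_matrix_P)
    show "A ** A + A ** A ** A = all_ones + Z + M.P"
      unfolding A_eq by (rule M.A_sq_plus_A_cubed)
  next
    fix \<sigma> assume "\<forall>u v. M.P $ u $ v = 1 \<longleftrightarrow> \<sigma> u = v"
    then have \<sigma>: "\<sigma> = M.\<sigma>" by (metis M.P_nth ext)
    show "\<not> automorphism G \<sigma>"
    proof
      assume "automorphism G \<sigma>"
      then have "R $ M.\<sigma> u $ M.\<sigma> v = R $ u $ v" "Z $ M.\<sigma> u $ M.\<sigma> v = Z $ u $ v" for u v
        by (simp_all add: automorphism_def mixed_graph_iso_def verts R Z edge_matrix_nth arc_matrix_nth \<sigma>)
      then show False by (rule M.not_automorphism_\<sigma>)
    qed
  next
    assume "M.P = R"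
    then interpret F: almost_moore_fixed R Z r z by unfold_locales
    let ?act = "fold (dihedral_act M.\<tau> M.\<sigma>)"
    fix u
    show "isomorphic G (cayley_graph (dihedral_group 5) {dihedral_rho 5, dihedral_s 5})"
    proof (rule isomorphic_cayley_graph_dihedral[OF wf verts])
      have "(v, w) \<in> adj G \<longleftrightarrow> R $ v $ w = 1 \<or> Z $ v $ w = 1" for v w
        by (simp add: R Z edge_matrix_nth arc_matrix_nth adj_def)
      then show "(v, w) \<in> adj G \<longleftrightarrow> w = M.\<tau> v \<or> w = M.\<sigma> v" for v w
        by (auto simp: F.R_nth M.Z_nth[OF F.z1])
      show "\<exists>w. ?act w u = v" for v
      proof -
        \<comment> \<open>The ten ends are the images of u under explicit words; as they exhaust the
          vertices, the action is transitive.\<close>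
        have ends: "F.ends u = map (\<lambda>w. ?act w u)
            [[], [gen_rho], [gen_s, gen_rho], [gen_rho, gen_s], [gen_rho, gen_rho],
             [gen_s, gen_rho, gen_s], [gen_s, gen_rho, gen_rho], [gen_rho, gen_s, gen_rho],
             [gen_rho, gen_rho, gen_s], [gen_rho, gen_rho, gen_rho]]"
          by (simp add: F.ends_def)
        have "v \<in> set (F.ends u)" by (simp add: F.set_ends)
        then obtain w where "v = ?act w u" unfolding ends set_map by (rule imageE)
        then show ?thesis by metis
      qed
    qed (simp_all add: F.\<tau>_5 F.\<tau>_\<sigma>_\<tau> F.card_eq_10)
  qed
qed

end
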